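(* Let $W$ be a real-valued potential function satisfying properties (1)–(3) listed in the context, let $\omega\in\mathbb{R}$, and let $(u_0,v_0)$ with $v_0=\bar u_0$ be a decaying solution on $x\in\mathbb{R}$ of $$ i u_0' = \omega u_0 - v_0 + \partial_{\bar u_0} W(u_0,\bar u_0,v_0,\bar v_0),\qquad -i v_0' = \omega v_0 - u_0 + \partial_{\bar v_0} W(u_0,\bar u_0,v_0,\bar v_0). $$ Then the linearized coupled-mode system $$ H_\omega\mathbf{U}=i\lambda\sigma\mathbf{U},\qquad \sigma=\mathrm{diag}(1,-1,1,-1), $$ is equivalent to the block-diagonalized eigenvalue problems $$ \sigma_3H_-\sigma_3H_+\mathbf{V}_1=\gamma\mathbf{V}_1,\qquad \sigma_3H_+\sigma_3H_-\mathbf{V}_2=\gamma\mathbf{V}_2,\qquad \gamma=-\lambda^2, $$ where $\mathbf{V}_1,\mathbf{V}_2$ are $\mathbb{C}^2$-valued and $\sigma_3=\mathrm{diag}(1,-1)$. That is: if $\mathbf{U}$ solves the linearized system with parameter $\lambda$, then the components of $(\mathbf{V}_1,\mathbf{V}_2)^T=S^{-1}\mathbf{U}$ (with $S$ as in the context) satisfy the two displayed equations with $\gamma=-\lambda^2$; and $\lambda\in\mathbb{C}$ is an eigenvalue of the linearized system if and only if $\gamma=-\lambda^2$ is an eigenvalue of the first (equivalently, of the second) of the two problems.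
   Context: $W=W(u,\bar u,v,\bar v)$ is a function of $(u,v)\in\mathbb{C}^2$; $\partial_u,\partial_{\bar u},\partial_v,\partial_{\bar v}$ are Wirtinger derivatives ($u,\bar u,v,\bar v$ treated as independent), and $\partial_{u_0}$, $\partial^2_{\bar u_0 v_0}$, etc. denote these derivatives of $W$ evaluated at $(u,v)=(u_0(x),v_0(x))$; those that appear are understood to exist. Properties: (1) gauge invariance: $W(u,\bar u,v,\bar v)=W(e^{i\alpha}u,e^{-i\alpha}\bar u,e^{i\alpha}v,e^{-i\alpha}\bar v)$ for all $\alpha\in\mathbb{R}$; (2) symmetry under the interchange $(u,v)\mapsto(v,u)$: $W(u,\bar u,v,\bar v)=W(v,\bar v,u,\bar u)$; (3) $W$ is analytic in its variables near $u=v=0$ and $W=O(4)$, i.e. its Taylor expansion there starts with terms of degree four. A solution is decaying if $u_0(x),v_0(x)\to0$ as $|x|\to\infty$. $H_\omega=D(\partial_x)+V(x)$ acts on $\mathbb{C}^4$-valued functions, with $$ D=\begin{pmatrix}\omega-i\partial_x&0&-1&0\\0&\omega+i\partial_x&0&-1\\-1&0&\omega+i\partial_x&0\\0&-1&0&\omega-i\partial_x\end{pmatrix}, $$ $$ V=\begin{pmatrix}\partial^2_{\bar u_0u_0}&\partial^2_{\bar u_0^2}&\partial^2_{\bar u_0v_0}&\partial^2_{\bar u_0\bar v_0}\\ \partial^2_{u_0^2}&\partial^2_{u_0\bar u_0}&\partial^2_{u_0v_0}&\partial^2_{u_0\bar v_0}\\ \partial^2_{\bar v_0u_0}&\partial^2_{\bar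 v_0\bar u_0}&\partial^2_{\bar v_0v_0}&\partial^2_{\bar v_0^2}\\ \partial^2_{v_0u_0}&\partial^2_{v_0\bar u_0}&\partial^2_{v_0^2}&\partial^2_{v_0\bar v_0}\end{pmatrix}W(u_0,\bar u_0,v_0,\bar v_0). $$ $H_\pm$ act on $\mathbb{C}^2$-valued functions: $$ H_\pm=\begin{pmatrix}\omega-i\partial_x&\mp1\\ \mp1&\omega+i\partial_x\end{pmatrix}+\begin{pmatrix}\partial^2_{\bar u_0u_0}\pm\partial^2_{\bar u_0\bar v_0}&\partial^2_{\bar u_0^2}\pm\partial^2_{\bar u_0v_0}\\ \partial^2_{u_0^2}\pm\partial^2_{u_0\bar v_0}&\partial^2_{\bar u_0u_0}\pm\partial^2_{u_0v_0}\end{pmatrix}W(u_0,\bar u_0,v_0,\bar v_0). $$ $$ S=\frac{1}{\sqrt2}\begin{pmatrix}1&0&1&0\\0&1&0&1\\0&1&0&-1\\1&0&-1&0\end{pmatrix},\qquad S^{-1}=S^T. $$ Eigenvalues are understood with eigenvectors in $L^2(\mathbb{R})$ lying in the natural domain of the operators (so that $H_+\mathbf V_1$, resp. $H_-\mathbf V_2$, is again in the domain of $H_-$, resp. $H_+$).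
   Formalization: Adds W(ū,u,v̄,v)=W(u,ū,v,v̄), without which block-diagonalization can fail; W is C² near the orbit and 0; for the second problem, "λ eigenvalue ⇒ −λ² eigenvalue" is claimed only if λ≠0, |ω|≠1 or u₀∈L², as it can fail otherwise. *)

theory Defs
  imports "HOL-Analysis.Analysis"
begin

section \<open>Wirtinger derivatives on \<open>\<complex>\<^sup>2\<close>\<close>

definition d_u :: "(complex \<times> complex \<Rightarrow> complex) \<Rightarrow> complex \<times> complex \<Rightarrow> complex" where
  "d_u f = (\<lambda>(u, v).
     (vector_derivative (\<lambda>t::real. f (u + of_real t, v)) (at 0)
      - \<i> * vector_derivative (\<lambda>t::real. f (u + \<i> * of_real t, v)) (at 0)) / 2)"

definition d_ubar :: "(complex \<times> complex \<Rightarrow> complex) \<Rightarrow> complex \<times> complex \<Rightarrow> complex" where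
  "d_ubar f = (\<lambda>(u, v).
     (vector_derivative (\<lambda>t::real. f (u + of_real t, v)) (at 0)
      + \<i> * vector_derivative (\<lambda>t::real. f (u + \<i> * of_real t, v)) (at 0)) / 2)"

definition d_v :: "(complex \<times> complex \<Rightarrow> complex) \<Rightarrow> complex \<times> complex \<Rightarrow> complex" where
  "d_v f = (\<lambda>(u, v).
     (vector_derivative (\<lambda>t::real. f (u, v + of_real t)) (at 0)
      - \<i> * vector_derivative (\<lambda>t::real. f (u, v + \<i> * of_real t)) (at 0)) / 2)"

definition d_vbar :: "(complex \<times> complex \<Rightarrow> complex) \<Rightarrow> complex \<times> complex \<Rightarrow> complex" where
  "d_vbar f = (\<lambda>(u, v).
     (vector_derivative (\<lambda>t::real. f (u, v + of_real t)) (at 0)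
      + \<i> * vector_derivative (\<lambda>t::real. f (u, v + \<i> * of_real t)) (at 0)) / 2)"

section \<open>The potential\<close>

text \<open>The potential \<open>W(u, \<bar>u, v, \<bar>v)\<close> is a real function of the pair \<open>(u, v)\<close>.\<close>

definition gauge_invariant :: "(complex \<times> complex \<Rightarrow> real) \<Rightarrow> bool" where
  "gauge_invariant W \<longleftrightarrow> (\<forall>\<alpha> u v. W (cis \<alpha> * u, cis \<alpha> * v) = W (u, v))"

definition swap_symmetric :: "(complex \<times> complex \<Rightarrow> real) \<Rightarrow> bool" where
  "swap_symmetric W \<longleftrightarrow> (\<forall>u v. W (v, u) = W (u, v))"

text \<open>
  A function of the four independent arguments \<open>u, \<bar>u, v, \<bar>v\<close> that is real (its Taylor
  coefficients are real) satisfies \<open>W(\<bar>u, u, \<bar>v, v) = cnj (W(u, \<bar>u, v, \<bar>v))\<close>; as the values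
  on \<open>\<complex>\<^sup>2\<close> are real, this is the condition below. It does not follow from real values, gauge
  invariance and the interchange symmetry: \<open>i (|u|^2 - |v|^2) (u \<bar>v - \<bar>u v)\<close> has these three
  properties, but changes sign under conjugation. Without the condition, \<open>W\<close> need not be a
  function of \<open>|u|^2 + |v|^2\<close>, \<open>|u|^2 |v|^2\<close>, \<open>u \<bar>v + \<bar>u v\<close>, and the linearization at
  \<open>v\<^sub>0 = \<bar>u\<^sub>0\<close> need not be block-diagonalized by \<open>S\<close>.
\<close>

definition conj_symmetric :: "(complex \<times> complex \<Rightarrow> real) \<Rightarrow> bool" where
  "conj_symmetric W \<longleftrightarrow> (\<forall>u v. W (cnj u, cnj v) = W (u, v))"

text \<open>
  Real-analyticity near the origin is absolute convergence of the Taylor series in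
  \<open>u, \<bar>u, v, \<bar>v\<close>; \<open>W = O(4)\<close> says that all terms of degree at most three vanish.
\<close>

definition analytic_order4 :: "(complex \<times> complex \<Rightarrow> real) \<Rightarrow> bool" where
  "analytic_order4 W \<longleftrightarrow>
     (\<exists>(c :: nat \<times> nat \<times> nat \<times> nat \<Rightarrow> complex) r. r > 0 \<and>
        (\<forall>j k l m. j + k + l + m < 4 \<longrightarrow> c (j, k, l, m) = 0) \<and>
        (\<forall>u v. norm u < r \<and> norm v < r \<longrightarrow>
           ((\<lambda>(j, k, l, m). c (j, k, l, m) * u ^ j * cnj u ^ k * v ^ l * cnj v ^ m)
              has_sum of_real (W (u, v))) UNIV))"

text \<open>Twice continuously (Frechet) differentiable over the reals; meant for open sets.\<close>

definition C2_on :: "('a::real_normed_vector \<Rightarrow> 'b::real_normed_vector) \<Rightarrow> 'a set \<Rightarrow> bool" where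
  "C2_on f G \<longleftrightarrow>
     (\<exists>(f' :: 'a \<Rightarrow> 'a \<Rightarrow>\<^sub>L 'b) (f'' :: 'a \<Rightarrow> 'a \<Rightarrow>\<^sub>L ('a \<Rightarrow>\<^sub>L 'b)).
        (\<forall>z\<in>G. (f has_derivative blinfun_apply (f' z)) (at z)) \<and>
        (\<forall>z\<in>G. (f' has_derivative blinfun_apply (f'' z)) (at z)) \<and>
        continuous_on G f'')"

section \<open>Stationary solutions\<close>

definition stationary_solution ::
  "(complex \<times> complex \<Rightarrow> real) \<Rightarrow> real \<Rightarrow> (real \<Rightarrow> complex) \<Rightarrow> (real \<Rightarrow> complex) \<Rightarrow> bool" where
  "stationary_solution W \<omega> u0 v0 \<longleftrightarrow>
     (\<forall>x. \<exists>u' v'.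
        (u0 has_vector_derivative u') (at x) \<and> (v0 has_vector_derivative v') (at x) \<and>
        \<i> * u' = of_real \<omega> * u0 x - v0 x + d_ubar (\<lambda>z. of_real (W z)) (u0 x, v0 x) \<and>
        - \<i> * v' = of_real \<omega> * v0 x - u0 x + d_vbar (\<lambda>z. of_real (W z)) (u0 x, v0 x))"

definition decaying :: "(real \<Rightarrow> complex) \<Rightarrow> (real \<Rightarrow> complex) \<Rightarrow> bool" where
  "decaying u0 v0 \<longleftrightarrow> (u0 \<longlongrightarrow> 0) at_infinity \<and> (v0 \<longlongrightarrow> 0) at_infinity"

section \<open>First-order differential operators on the line\<close>

definition square_integrable :: "(real \<Rightarrow> 'a::euclidean_space) \<Rightarrow> bool" where
  "square_integrable f \<longleftrightarrow>
     f \<in> borel_measurable lborel \<and> integrable lborel (\<lambda>x. (norm (f x))\<^sup>2)"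

text \<open>\<open>f\<close> is locally absolutely continuous with derivative \<open>g\<close> (determined almost everywhere).\<close>

definition ac_derivative :: "(real \<Rightarrow> 'a::euclidean_space) \<Rightarrow> (real \<Rightarrow> 'a) \<Rightarrow> bool" where
  "ac_derivative f g \<longleftrightarrow>
     (\<forall>a b. a \<le> b \<longrightarrow> set_integrable lborel {a..b} g \<and>
        f b - f a = set_lebesgue_integral lborel {a..b} g)"

text \<open>
  A first-order differential expression is given as a function \<open>L\<close> of a vector function \<open>f\<close> and
  its derivative \<open>f'\<close>. \<open>applies L f h\<close> says \<open>L f = h\<close> almost everywhere, for locally absolutely
  continuous \<open>f\<close>. \<open>applies_L2\<close> is the graph of the corresponding operator in \<open>L\<^sup>2\<close> with its natural
  domain, the \<open>f \<in> L\<^sup>2\<close> that are locally absolutely continuous with \<open>L f \<in> L\<^sup>2\<close> (for the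
  operators below this is \<open>H\<^sup>1\<close>, as their coefficients are bounded). Elements of the domain are
  represented by their continuous representatives.
\<close>

type_synonym 'n diff_expr =
  "(real \<Rightarrow> complex ^ 'n) \<Rightarrow> (real \<Rightarrow> complex ^ 'n) \<Rightarrow> real \<Rightarrow> complex ^ 'n"

definition applies ::
  "'n::finite diff_expr \<Rightarrow> (real \<Rightarrow> complex ^ 'n) \<Rightarrow> (real \<Rightarrow> complex ^ 'n) \<Rightarrow> bool" where
  "applies L f h \<longleftrightarrow> (\<exists>f'. ac_derivative f f' \<and> (AE x in lborel. L f f' x = h x))"

definition applies_L2 ::
  "'n::finite diff_expr \<Rightarrow> (real \<Rightarrow> complex ^ 'n) \<Rightarrow> (real \<Rightarrow> complex ^ 'n) \<Rightarrow> bool" where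
  "applies_L2 L f h \<longleftrightarrow> applies L f h \<and> square_integrable f \<and> square_integrable h"

section \<open>The linearized operators\<close>

lemma vector_4 [simp]:
  "(vector [a, b, c, d] :: 'a::zero ^ 4) $ 1 = a"
  "(vector [a, b, c, d] :: 'a::zero ^ 4) $ 2 = b"
  "(vector [a, b, c, d] :: 'a::zero ^ 4) $ 3 = c"
  "(vector [a, b, c, d] :: 'a::zero ^ 4) $ 4 = d"
  by (simp_all add: vector_def)

definition V_matrix ::
  "(complex \<times> complex \<Rightarrow> real) \<Rightarrow> complex \<times> complex \<Rightarrow> complex ^ 4 ^ 4" where
  "V_matrix W z = (let w = (\<lambda>z. of_real (W z)) in
     vector [
       vector [d_ubar (d_u w) z, d_ubar (d_ubar w) z, d_ubar (d_v w) z, d_ubar (d_vbar w) z],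
       vector [d_u (d_u w) z,    d_u (d_ubar w) z,    d_u (d_v w) z,    d_u (d_vbar w) z],
       vector [d_vbar (d_u w) z, d_vbar (d_ubar w) z, d_vbar (d_v w) z, d_vbar (d_vbar w) z],
       vector [d_v (d_u w) z,    d_v (d_ubar w) z,    d_v (d_v w) z,    d_v (d_vbar w) z]])"

definition H_omega ::
  "(complex \<times> complex \<Rightarrow> real) \<Rightarrow> real \<Rightarrow> (real \<Rightarrow> complex) \<Rightarrow> (real \<Rightarrow> complex) \<Rightarrow> 4 diff_expr" where
  "H_omega W \<omega> u0 v0 U U' x =
     vector [
       of_real \<omega> * U x $ 1 - \<i> * U' x $ 1 - U x $ 3,
       of_real \<omega> * U x $ 2 + \<i> * U' x $ 2 - U x $ 4,
       - U x $ 1 + of_real \<omega> * U x $ 3 + \<i> * U' x $ 3,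
       - U x $ 2 + of_real \<omega> * U x $ 4 - \<i> * U' x $ 4]
     + V_matrix W (u0 x, v0 x) *v U x"

text \<open>\<open>H_sign 1\<close> is \<open>H\<^sub>+\<close> and \<open>H_sign (-1)\<close> is \<open>H\<^sub>-\<close>.\<close>

definition V_sign_matrix ::
  "complex \<Rightarrow> (complex \<times> complex \<Rightarrow> real) \<Rightarrow> complex \<times> complex \<Rightarrow> complex ^ 2 ^ 2" where
  "V_sign_matrix s W z = (let w = (\<lambda>z. of_real (W z)) in
     vector [
       vector [d_ubar (d_u w) z + s * d_ubar (d_vbar w) z,
               d_ubar (d_ubar w) z + s * d_ubar (d_v w) z],
       vector [d_u (d_u w) z + s * d_u (d_vbar w) z,
               d_ubar (d_u w) z + s * d_u (d_v w) z]])"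

definition H_sign ::
  "complex \<Rightarrow> (complex \<times> complex \<Rightarrow> real) \<Rightarrow> real \<Rightarrow> (real \<Rightarrow> complex) \<Rightarrow> (real \<Rightarrow> complex)
     \<Rightarrow> 2 diff_expr" where
  "H_sign s W \<omega> u0 v0 V V' x =
     vector [
       of_real \<omega> * V x $ 1 - \<i> * V' x $ 1 - s * V x $ 2,
       - s * V x $ 1 + of_real \<omega> * V x $ 2 + \<i> * V' x $ 2]
     + V_sign_matrix s W (u0 x, v0 x) *v V x"

abbreviation H_plus ::
  "(complex \<times> complex \<Rightarrow> real) \<Rightarrow> real \<Rightarrow> (real \<Rightarrow> complex) \<Rightarrow> (real \<Rightarrow> complex) \<Rightarrow> 2 diff_expr" where
  "H_plus \<equiv> H_sign 1"

abbreviation H_minus ::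
  "(complex \<times> complex \<Rightarrow> real) \<Rightarrow> real \<Rightarrow> (real \<Rightarrow> complex) \<Rightarrow> (real \<Rightarrow> complex) \<Rightarrow> 2 diff_expr" where
  "H_minus \<equiv> H_sign (- 1)"

definition sigma :: "complex ^ 4 ^ 4" where
  "sigma = vector [vector [1, 0, 0, 0], vector [0, - 1, 0, 0],
                   vector [0, 0, 1, 0], vector [0, 0, 0, - 1]]"

definition sigma3 :: "complex ^ 2 ^ 2" where
  "sigma3 = vector [vector [1, 0], vector [0, - 1]]"

definition S_matrix :: "complex ^ 4 ^ 4" where
  "S_matrix = (\<chi> i j. of_real (1 / sqrt 2) *
     (vector [vector [1, 0, 1, 0], vector [0, 1, 0, 1],
              vector [0, 1, 0, - 1], vector [1, 0, - 1, 0]] :: complex ^ 4 ^ 4) $ i $ j)"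

definition V1_part :: "complex ^ 4 \<Rightarrow> complex ^ 2" where
  "V1_part U = (let V = matrix_inv S_matrix *v U in vector [V $ 1, V $ 2])"

definition V2_part :: "complex ^ 4 \<Rightarrow> complex ^ 2" where
  "V2_part U = (let V = matrix_inv S_matrix *v U in vector [V $ 3, V $ 4])"

section \<open>The eigenvalue problems\<close>

text \<open>
  The parameter \<open>app\<close> is \<open>applies\<close> (solutions without integrability requirement) or
  \<open>applies_L2\<close> (the operators in \<open>L\<^sup>2\<close>).
\<close>

definition linearized_problem ::
  "(4 diff_expr \<Rightarrow> (real \<Rightarrow> complex ^ 4) \<Rightarrow> (real \<Rightarrow> complex ^ 4) \<Rightarrow> bool)
     \<Rightarrow> (complex \<times> complex \<Rightarrow> real) \<Rightarrow> real \<Rightarrow> (real \<Rightarrow> complex) \<Rightarrow> (real \<Rightarrow> complex)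
     \<Rightarrow> complex \<Rightarrow> (real \<Rightarrow> complex ^ 4) \<Rightarrow> bool" where
  "linearized_problem app W \<omega> u0 v0 lam U \<longleftrightarrow>
     app (H_omega W \<omega> u0 v0) U (\<lambda>x. (\<i> * lam) *s (sigma *v U x))"

text \<open>
  \<open>\<sigma>\<^sub>3 A \<sigma>\<^sub>3 B V = \<gamma> V\<close>, where \<open>F = B V\<close> and \<open>G = A \<sigma>\<^sub>3 F\<close>; in particular \<open>\<sigma>\<^sub>3 B V\<close> has to lie in
  the domain of \<open>A\<close>.
\<close>

definition product_problem ::
  "(2 diff_expr \<Rightarrow> (real \<Rightarrow> complex ^ 2) \<Rightarrow> (real \<Rightarrow> complex ^ 2) \<Rightarrow> bool)
     \<Rightarrow> 2 diff_expr \<Rightarrow> 2 diff_expr \<Rightarrow> complex \<Rightarrow> (real \<Rightarrow> complex ^ 2) \<Rightarrow> bool" where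
  "product_problem app A B \<gamma> V \<longleftrightarrow>
     (\<exists>F G. app B V F \<and> app A (\<lambda>x. sigma3 *v F x) G \<and>
        (AE x in lborel. sigma3 *v G x = \<gamma> *s V x))"

text \<open>
  At \<open>\<lambda> = 0\<close> the two product problems behave differently. A nonzero \<open>u\<^sub>0\<close> gives the solution
  \<open>(u\<^sub>0', \<bar>u\<^sub>0')\<close> of \<open>H\<^sub>+ V = 0\<close> and the solution \<open>(i u\<^sub>0, -i \<bar>u\<^sub>0)\<close> of \<open>H\<^sub>- V = 0\<close>. If \<open>|\<omega>| = 1\<close>,
  a decaying \<open>u\<^sub>0\<close> need not be in \<open>L\<^sup>2\<close>, and then \<open>0\<close> can be an eigenvalue of the linearized
  and of the first product problem only: for \<open>\<omega> = 1\<close>, \<open>W = -2 (|u|^6 + |v|^6)\<close> there is a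
  decaying solution with \<open>|u\<^sub>0(x)|^2 = 1 / sqrt (1 + 16 x^2)\<close>.
\<close>

definition linearized_eigenvalue ::
  "(complex \<times> complex \<Rightarrow> real) \<Rightarrow> real \<Rightarrow> (real \<Rightarrow> complex) \<Rightarrow> (real \<Rightarrow> complex) \<Rightarrow> complex \<Rightarrow> bool" where
  "linearized_eigenvalue W \<omega> u0 v0 lam \<longleftrightarrow>
     (\<exists>U. (\<exists>x. U x \<noteq> 0) \<and> linearized_problem applies_L2 W \<omega> u0 v0 lam U)"

definition product_eigenvalue :: "2 diff_expr \<Rightarrow> 2 diff_expr \<Rightarrow> complex \<Rightarrow> bool" where
  "product_eigenvalue A B \<gamma> \<longleftrightarrow>
     (\<exists>V. (\<exists>x. V x \<noteq> 0) \<and> product_problem applies_L2 A B \<gamma> V)"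

end

theory Submission
  imports Defs
begin

text \<open>
  The reflection \<open>(u, v) \<mapsto> (\<bar>v, \<bar>u)\<close> leaves \<open>W\<close> invariant and fixes the points
  \<open>(u\<^sub>0, \<bar>u\<^sub>0)\<close>, so the Hessian of \<open>W\<close> commutes with it there; this is the block
  diagonalization by \<open>S\<close>, and the linearized problem becomes
  \<open>H\<^sub>+ V\<^sub>1 = i \<lambda> \<sigma>\<^sub>3 V\<^sub>2\<close>, \<open>H\<^sub>- V\<^sub>2 = i \<lambda> \<sigma>\<^sub>3 V\<^sub>1\<close>. For \<open>\<lambda> \<noteq> 0\<close> each of \<open>V\<^sub>1\<close>, \<open>V\<^sub>2\<close> determines the
  other one.

  For \<open>\<lambda> = 0\<close> the kernels of \<open>H\<^sub>\<plusminus>\<close> in \<open>L\<^sup>2\<close> have to be compared. Gauge invariance gives the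
  solution \<open>(i u\<^sub>0, -i \<bar>u\<^sub>0)\<close> of \<open>H\<^sub>- V = 0\<close>, and differentiating the stationary equation gives the
  solution \<open>(u\<^sub>0', \<bar>u\<^sub>0')\<close> of \<open>H\<^sub>+ V = 0\<close>. The Wronskian of the first one with an element of the
  kernel of \<open>H\<^sub>-\<close> vanishes, so a nontrivial kernel of \<open>H\<^sub>-\<close> forces \<open>u\<^sub>0 \<in> L\<^sup>2\<close> and then
  \<open>u\<^sub>0' \<in> L\<^sup>2\<close>. Conversely, the conserved energy \<open>2 \<omega> |u\<^sub>0|^2 - 2 Re u\<^sub>0^2 + W = 0\<close> shows that
  \<open>u\<^sub>0 = 0\<close> if \<open>|\<omega>| > 1\<close> and \<open>u\<^sub>0 \<in> L\<^sup>2\<close> if \<open>|\<omega>| < 1\<close>. If \<open>u\<^sub>0 = 0\<close>, both operators have constant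
  coefficients and no kernel.
\<close>

section \<open>Locally absolutely continuous and square integrable functions\<close>

lemma ac_derivative_bounded_linear:
  assumes "ac_derivative f g" "bounded_linear T"
  shows "ac_derivative (\<lambda>x. T (f x)) (\<lambda>x. T (g x))"
proof -
  interpret bounded_linear T by fact
  have eq: "(\<lambda>x. indicator A x *\<^sub>R T (g x)) = (\<lambda>x. T (indicator A x *\<^sub>R g x))" for A :: "real set"
    by (simp add: scaleR)
  show ?thesis
    unfolding ac_derivative_def
  proof (intro allI impI)
    fix a b :: real assume "a \<le> b"
    then have *: "set_integrable lborel {a..b} g" "f b - f a = set_lebesgue_integral lborel {a..b} g"
      using assms(1) unfolding ac_derivative_def by auto
    then show "set_integrable lborel {a..b} (\<lambda>x. T (g x)) \<and>
        T (f b) - T (f a) = set_lebesgue_integral lborel {a..b} (\<lambda>x. T (g x))"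
      using integral_bounded_linear[OF assms(2) *(1)[unfolded set_integrable_def]]
      unfolding set_integrable_def set_lebesgue_integral_def eq diff[symmetric]
      by (auto intro: integrable_bounded_linear[OF assms(2)])
  qed
qed

lemma ac_derivative_add:
  assumes "ac_derivative f f'" "ac_derivative g g'"
  shows "ac_derivative (\<lambda>x. f x + g x) (\<lambda>x. f' x + g' x)"
  using assms unfolding ac_derivative_def
  by (auto simp: set_integral_add algebra_simps)

lemma ac_derivativeI:
  assumes "\<And>x. (f has_vector_derivative g x) (at x)" "continuous_on UNIV g"
  shows "ac_derivative f g"
  unfolding ac_derivative_def
proof (intro allI impI conjI)
  fix a b :: real assume ab: "a \<le> b"
  have c: "continuous_on {a..b} g" using assms(2) continuous_on_subset by blast
  then show "set_integrable lborel {a..b} g" by (rule borel_integrable_atLeastAtMost')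
  show "f b - f a = set_lebesgue_integral lborel {a..b} g"
    unfolding set_lebesgue_integral_def
    using integral_FTC_atLeastAtMost[OF ab has_vector_derivative_at_within[OF assms(1)] c] by simp
qed

text \<open>Changing \<open>f'\<close> on a null set does not affect its integrals, so
  \<open>f\<close> is a primitive of the continuous \<open>g\<close>. This turns equations that hold
  almost everywhere into classical differential equations.\<close>

lemma ac_derivative_has_vector_derivative:
  assumes "ac_derivative f f'" "AE x in lborel. f' x = g x" "continuous_on UNIV g"
  shows "(f has_vector_derivative g x) (at x)"
proof -
  \<comment> \<open>A compact interval with \<open>x\<close> in its interior, so that the derivative
    within the interval is the derivative at \<open>x\<close>.\<close>
  define a b where "a = x - 1" and "b = x + 1"
  have c: "continuous_on {a..b} g" using assms(3) continuous_on_subset by blast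
  have eq: "f y = f a + integral {a..y} g" if "y \<in> {a..b}" for y
  proof -
    have ay: "a \<le> y" using that by auto
    have "set_lebesgue_integral lborel {a..y} f' = set_lebesgue_integral lborel {a..y} g"
      unfolding set_lebesgue_integral_def
    proof (rule integral_cong_AE)
      show "(\<lambda>x. indicator {a..y} x *\<^sub>R f' x) \<in> borel_measurable lborel"
        using assms(1) ay borel_measurable_integrable unfolding ac_derivative_def set_integrable_def by metis
      show "(\<lambda>x. indicator {a..y} x *\<^sub>R g x) \<in> borel_measurable lborel"
        using borel_measurable_continuous_onI[OF assms(3)] by measurable
      show "AE x in lborel. indicator {a..y} x *\<^sub>R f' x = indicator {a..y} x *\<^sub>R g x"
        using assms(2) by auto
    qed
    also have "\<dots> = integral {a..y} g"
      by (rule set_borel_integral_eq_integral, rule borel_integrable_atLeastAtMost')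
         (use assms(3) continuous_on_subset in blast)
    finally have "set_lebesgue_integral lborel {a..y} f' = integral {a..y} g" .
    moreover have "f y - f a = set_lebesgue_integral lborel {a..y} f'"
      using assms(1) ay unfolding ac_derivative_def by blast
    ultimately show ?thesis by (simp add: algebra_simps)
  qed
  have x: "x \<in> {a..b}" by (simp add: a_def b_def)
  have "((\<lambda>y. f a + integral {a..y} g) has_vector_derivative g x) (at x within {a..b})"
    using has_vector_derivative_add[OF has_vector_derivative_const integral_has_vector_derivative[OF c x]] by simp
  then have "(f has_vector_derivative g x) (at x within {a..b})"
    by (rule has_vector_derivative_transform[OF x, rotated]) (rule eq)
  then show ?thesis
    using at_within_Icc_at[of a x b] by (simp add: a_def b_def)
qed

lemma ac_derivative_continuous:
  assumes "ac_derivative f g"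
  shows "continuous_on UNIV f"
proof -
  have "isCont f x" for x
  proof -
    define a b where "a = x - 1" and "b = x + 1"
    have si: "set_integrable lborel {a..y} g" if "a \<le> y" for y
      using assms that unfolding ac_derivative_def by auto
    have "g integrable_on {a..b}"
      using set_borel_integral_eq_integral(1)[OF si] by (simp add: a_def b_def)
    then have cont: "continuous_on {a..b} (\<lambda>y. f a + integral {a..y} g)"
      by (intro continuous_intros indefinite_integral_continuous_1)
    have eq: "f a + integral {a..y} g = f y" if "y \<in> {a..b}" for y
    proof -
      have "a \<le> y" using that by simp
      with assms have "f y - f a = set_lebesgue_integral lborel {a..y} g"
        unfolding ac_derivative_def by blast
      then show ?thesis
        using set_borel_integral_eq_integral(2)[OF si[OF \<open>a \<le> y\<close>]] by (simp add: algebra_simps)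
    qed
    have "continuous_on {a..b} f"
      by (rule continuous_on_eq[OF cont]) (rule eq)
    then have "continuous_on {a<..<b} f"
      by (rule continuous_on_subset) auto
    then show ?thesis
      using continuous_on_eq_continuous_at[of "{a<..<b}" f] by (simp add: a_def b_def)
  qed
  then show ?thesis by (simp add: continuous_at_imp_continuous_on)
qed

lemma square_integrable_bound:
  fixes f :: "real \<Rightarrow> 'a::euclidean_space" and g :: "real \<Rightarrow> 'b::euclidean_space"
  assumes "square_integrable g" "f \<in> borel_measurable lborel" "\<And>x. norm (f x) \<le> C * norm (g x)"
  shows "square_integrable f"
  unfolding square_integrable_def
proof
  show "integrable lborel (\<lambda>x. (norm (f x))\<^sup>2)"
  proof (rule Bochner_Integration.integrable_bound)
    show "integrable lborel (\<lambda>x. C\<^sup>2 * (norm (g x))\<^sup>2)"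
      using assms(1) by (simp add: square_integrable_def)
    show "(\<lambda>x. (norm (f x))\<^sup>2) \<in> borel_measurable lborel"
      using assms(2) by measurable
    show "AE x in lborel. norm ((norm (f x))\<^sup>2) \<le> norm (C\<^sup>2 * (norm (g x))\<^sup>2)"
      using power_mono[OF assms(3), where n = 2] by (simp add: power_mult_distrib)
  qed
qed fact

lemma square_integrable_bounded_linear:
  fixes f :: "real \<Rightarrow> 'a::euclidean_space" and T :: "'a \<Rightarrow> 'b::euclidean_space"
  assumes "square_integrable f" "bounded_linear T"
  shows "square_integrable (\<lambda>x. T (f x))"
proof -
  obtain K where K: "\<And>x. norm (T x) \<le> norm x * K"
    using assms(2) bounded_linear.bounded by blast
  have "(\<lambda>x. T (f x)) \<in> borel_measurable lborel"
    using measurable_compose[OF _ borel_measurable_continuous_onI[OF linear_continuous_on[OF assms(2)]]]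
      assms(1) unfolding square_integrable_def by blast
  then show ?thesis
    using square_integrable_bound[OF assms(1)] K by (metis mult.commute)
qed

lemma square_integrable_add:
  assumes "square_integrable f" "square_integrable g"
  shows "square_integrable (\<lambda>x. f x + g x)"
  unfolding square_integrable_def
proof
  have m: "f \<in> borel_measurable lborel" "g \<in> borel_measurable lborel"
    using assms by (auto simp: square_integrable_def)
  then show "(\<lambda>x. f x + g x) \<in> borel_measurable lborel" by measurable
  show "integrable lborel (\<lambda>x. (norm (f x + g x))\<^sup>2)"
  proof (rule Bochner_Integration.integrable_bound)
    show "integrable lborel (\<lambda>x. 2 * (norm (f x))\<^sup>2 + 2 * (norm (g x))\<^sup>2)"
      using assms by (simp add: square_integrable_def)
    show "(\<lambda>x. (norm (f x + g x))\<^sup>2) \<in> borel_measurable lborel"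
      using m by measurable
    have "(norm (f x + g x))\<^sup>2 \<le> 2 * (norm (f x))\<^sup>2 + 2 * (norm (g x))\<^sup>2" for x
    proof -
      have "(norm (f x + g x))\<^sup>2 \<le> (norm (f x) + norm (g x))\<^sup>2"
        by (simp add: norm_triangle_ineq power_mono)
      then show ?thesis using zero_le_power2[of "norm (f x) - norm (g x)"]
        by (simp add: power2_eq_square algebra_simps)
    qed
    then show "AE x in lborel. norm ((norm (f x + g x))\<^sup>2)
        \<le> norm (2 * (norm (f x))\<^sup>2 + 2 * (norm (g x))\<^sup>2)"
      by simp
  qed
qed

lemma square_integrable_zero [simp]: "square_integrable (\<lambda>x. 0)"
  by (simp add: square_integrable_def)

text \<open>A function of norm at least \<open>d\<close> on a half-line has infinite square
  integral. The sign of \<open>s\<close> selects the half-line, and \<open>s = 0\<close> allows the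
  whole line.\<close>

lemma square_integrable_not_bounded_below:
  assumes "square_integrable f" "d > 0"
  shows "\<exists>x. 0 \<le> s * x \<and> norm (f x) < d"
proof (rule ccontr)
  assume "\<not> ?thesis"
  then have ge: "d \<le> norm (f x)" if "0 \<le> s * x" for x using that not_le by blast
  define I where "I = (\<integral>x. (norm (f x))\<^sup>2 \<partial>lborel)"
  have "r * d\<^sup>2 \<le> I" if "r \<ge> 0" for r
  proof -
    define a where "a = (if s \<ge> 0 then 0 else - r)"
    have a: "0 \<le> s * x" if "x \<in> {a..a + r}" for x
      using that by (auto simp: a_def zero_le_mult_iff split: if_splits)
    have "(\<integral>x. indicator {a..a + r} x * d\<^sup>2 \<partial>lborel) \<le> I"
      unfolding I_def
    proof (rule integral_mono)
      show "integrable lborel (\<lambda>x. indicator {a..a + r} x * d\<^sup>2)"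
        by (intro integrable_mult_left integrable_real_indicator) (auto simp: emeasure_lborel_Icc_eq)
      show "integrable lborel (\<lambda>x. (norm (f x))\<^sup>2)"
        using assms(1) by (simp add: square_integrable_def)
      show "indicator {a..a + r} x * d\<^sup>2 \<le> (norm (f x))\<^sup>2" for x
        using power_mono[OF ge[OF a], of x 2] assms(2) by (auto simp: indicator_def)
    qed
    then show ?thesis using that by simp
  qed
  \<comment> \<open>This length makes the lower bound equal to \<open>\<bar>I\<bar> + 1\<close>,
    which exceeds \<open>I\<close>.\<close>
  from this[of "(\<bar>I\<bar> + 1) / d\<^sup>2"] assms(2) show False
    by (simp split: if_splits)
qed

section \<open>Linear systems on the line\<close>

text \<open>Gronwall's argument: the weight \<open>exp (- 2 * C * x)\<close> makes the squared norm
  nonincreasing, and it starts at zero.\<close>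

lemma ode_zero_forward:
  fixes f :: "real \<Rightarrow> 'a::real_inner"
  assumes "\<And>x. x \<in> {a..b} \<Longrightarrow> (f has_vector_derivative f' x) (at x)"
    and "\<And>x. x \<in> {a..b} \<Longrightarrow> norm (f' x) \<le> C * norm (f x)"
    and "f a = 0" "a \<le> b"
  shows "f b = 0"
proof -
  define g where "g x = exp (- 2 * C * x) * (f x \<bullet> f x)" for x
  have "g b \<le> g a"
  proof (rule DERIV_nonpos_imp_nonincreasing[OF \<open>a \<le> b\<close>])
    fix x assume x: "a \<le> x" "x \<le> b"
    have "((\<lambda>x. f x \<bullet> f x) has_vector_derivative (f x \<bullet> f' x + f' x \<bullet> f x)) (at x)"
      by (rule bounded_bilinear.has_vector_derivative[OF bounded_bilinear_inner]; use assms(1) x in simp)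
    then have d: "((\<lambda>x. f x \<bullet> f x) has_real_derivative 2 * (f x \<bullet> f' x)) (at x)"
      by (simp add: has_real_derivative_iff_has_vector_derivative inner_commute)
    have "(g has_real_derivative exp (- 2 * C * x) * (2 * (f x \<bullet> f' x) - 2 * C * (f x \<bullet> f x))) (at x)"
      unfolding g_def by (rule derivative_eq_intros d refl | simp add: algebra_simps)+
    moreover have "f x \<bullet> f' x \<le> C * (f x \<bullet> f x)"
    proof -
      have "f x \<bullet> f' x \<le> norm (f x) * norm (f' x)" by (rule norm_cauchy_schwarz)
      also have "\<dots> \<le> norm (f x) * (C * norm (f x))"
        using assms(2) x by (intro mult_left_mono) auto
      finally show ?thesis by (simp add: dot_square_norm power2_eq_square mult.left_commute)
    qed
    then have "exp (- 2 * C * x) * (2 * (f x \<bullet> f' x) - 2 * C * (f x \<bullet> f x)) \<le> 0"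
      by (intro mult_nonneg_nonpos) auto
    ultimately show "\<exists>y. (g has_real_derivative y) (at x) \<and> y \<le> 0"
      by blast
  qed
  then have "exp (- 2 * C * b) * (f b \<bullet> f b) \<le> 0"
    using assms(3) by (simp add: g_def)
  then have "f b \<bullet> f b \<le> 0"
    by (simp add: mult_le_0_iff)
  then show ?thesis by (metis inner_gt_zero_iff not_le)
qed

text \<open>The constant may depend on the compact interval, as it does for linear systems with
  continuous coefficients.\<close>

lemma ode_zero_unique:
  fixes f :: "real \<Rightarrow> 'a::real_inner"
  assumes "\<And>x. (f has_vector_derivative f' x) (at x)"
    and "\<And>R. \<exists>C. \<forall>x. \<bar>x\<bar> \<le> R \<longrightarrow> norm (f' x) \<le> C * norm (f x)"
    and "f x0 = 0"
  shows "f x = 0"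
proof -
  obtain C where C: "\<And>y. \<bar>y\<bar> \<le> max \<bar>x\<bar> \<bar>x0\<bar> \<Longrightarrow> norm (f' y) \<le> C * norm (f y)"
    using assms(2) by blast
  show ?thesis
  proof (cases "x0 \<le> x")
    case True
    show ?thesis
      by (rule ode_zero_forward[of x0 x f f' C]) (use assms C True in auto)
  next
    case False
    \<comment> \<open>Points to the left of \<open>x0\<close> are reached by running the reflected
      function forward.\<close>
    have "((\<lambda>y. f (- y)) has_vector_derivative - f' (- y)) (at y)" for y
    proof -
      have "(uminus has_vector_derivative - 1) (at y)"
        using has_vector_derivative_minus[OF has_vector_derivative_id] by (simp add: fun_Compl_def)
      then show ?thesis
        using vector_diff_chain_at[of uminus "- 1" y f "f' (- y)"] assms(1) by (simp add: o_def)
    qed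
    then have "f (- (- x)) = 0"
      by (rule ode_zero_forward[of "- x0" "- x" "\<lambda>y. f (- y)" "\<lambda>y. - f' (- y)" C])
         (use assms C False in auto)
    then show ?thesis by simp
  qed
qed

text \<open>The modulus of \<open>g\<close> is \<open>exp (Re k * x)\<close> times its value at
  zero, so it does not drop below that value where \<open>Re k * x\<close> is nonnegative; for
  \<open>Re k = 0\<close> this is the whole line.\<close>

lemma exponential_ode_not_square_integrable:
  fixes g :: "real \<Rightarrow> complex"
  assumes d: "\<And>x. (g has_vector_derivative k * g x) (at x)" and sq: "square_integrable g"
  shows "g x = 0"
proof -
  define e where "e x = exp (- (of_real x * k)) * g x" for x
  have ex: "((\<lambda>x. exp (- (of_real x * k))) has_vector_derivative - k * exp (- (of_real x * k))) (at x)"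
    for x :: real
    by (rule derivative_eq_intros refl has_vector_derivative_of_real
        field_vector_diff_chain_at[where g = exp, unfolded o_def] | simp)+
  have "(e has_vector_derivative 0) (at x)" for x
    unfolding e_def using has_vector_derivative_mult[OF ex d, of x] by (simp add: algebra_simps)
  then have e0: "e x = e 0" for x
    using has_vector_derivative_zero_constant[of UNIV e] by (metis UNIV_I convex_UNIV has_vector_derivative_at_within)
  have g: "g x = exp (of_real x * k) * e 0" for x
    unfolding e0[of x, symmetric] by (simp add: e_def exp_minus)
  have ng: "norm (g x) = exp (Re k * x) * norm (e 0)" for x
    by (simp add: g norm_mult mult.commute)
  have "e 0 = 0"
  proof (rule ccontr)
    assume "e 0 \<noteq> 0"
    then obtain x where "0 \<le> Re k * x" "norm (g x) < norm (e 0)"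
      using square_integrable_not_bounded_below[OF sq, of "norm (e 0)" "Re k"] by auto
    then show False
      using mult_right_mono[of 1 "exp (Re k * x)" "norm (e 0)"] by (simp add: ng)
  qed
  then show ?thesis by (simp add: g)
qed

text \<open>The equation \<open>H_sign s\<close> applied to \<open>(f, g)\<close> equals zero,
  solved for the derivatives; the diagonal \<open>\<alpha>\<close> is real and the off-diagonal
  entries \<open>\<beta>\<close>, \<open>cnj \<beta>\<close> are conjugate.\<close>

definition dirac_solution ::
  "(real \<Rightarrow> real) \<Rightarrow> (real \<Rightarrow> complex) \<Rightarrow> (real \<Rightarrow> complex) \<Rightarrow> (real \<Rightarrow> complex) \<Rightarrow> bool" where
  "dirac_solution \<alpha> \<beta> f g \<longleftrightarrow>
     (\<forall>x. (f has_vector_derivative - \<i> * (of_real (\<alpha> x) * f x + \<beta> x * g x)) (at x) \<and>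
          (g has_vector_derivative \<i> * (cnj (\<beta> x) * f x + of_real (\<alpha> x) * g x)) (at x))"

lemma dirac_solution_diff_mult:
  assumes "dirac_solution \<alpha> \<beta> f1 g1" "dirac_solution \<alpha> \<beta> f2 g2"
  shows "dirac_solution \<alpha> \<beta> (\<lambda>x. f1 x - c * f2 x) (\<lambda>x. g1 x - c * g2 x)"
  unfolding dirac_solution_def
proof (intro allI conjI)
  fix x
  note d = assms[unfolded dirac_solution_def, rule_format, of x]
  show "((\<lambda>x. f1 x - c * f2 x) has_vector_derivative
      - \<i> * (of_real (\<alpha> x) * (f1 x - c * f2 x) + \<beta> x * (g1 x - c * g2 x))) (at x)"
    using has_vector_derivative_diff[OF d(1)[THEN conjunct1]
        has_vector_derivative_mult_right[OF d(2)[THEN conjunct1], of c]]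
    by (simp add: algebra_simps)
  show "((\<lambda>x. g1 x - c * g2 x) has_vector_derivative
      \<i> * (cnj (\<beta> x) * (f1 x - c * f2 x) + of_real (\<alpha> x) * (g1 x - c * g2 x))) (at x)"
    using has_vector_derivative_diff[OF d(1)[THEN conjunct2]
        has_vector_derivative_mult_right[OF d(2)[THEN conjunct2], of c]]
    by (simp add: algebra_simps)
qed

lemma dirac_solution_unique:
  assumes sol: "dirac_solution \<alpha> \<beta> f g"
    and cont: "continuous_on UNIV \<alpha>" "continuous_on UNIV \<beta>"
    and zero: "f x0 = 0" "g x0 = 0"
  shows "f x = 0 \<and> g x = 0"
proof -
  define f' where "f' x = - \<i> * (of_real (\<alpha> x) * f x + \<beta> x * g x)" for x
  define g' where "g' x = \<i> * (cnj (\<beta> x) * f x + of_real (\<alpha> x) * g x)" for x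
  have "(f x, g x) = 0"
  proof (rule ode_zero_unique[where f = "\<lambda>x. (f x, g x)"])
    show "((\<lambda>x. (f x, g x)) has_vector_derivative (f' x, g' x)) (at x)" for x
      using sol unfolding dirac_solution_def f'_def g'_def
      by (intro has_vector_derivative_Pair) auto
    show "\<exists>C. \<forall>x. \<bar>x\<bar> \<le> R \<longrightarrow> norm (f' x, g' x) \<le> C * norm (f x, g x)" for R
    proof -
      \<comment> \<open>A continuous bound for the norm of the coefficient matrix; its maximum on a
        compact interval gives the constant.\<close>
      define h where "h x = 2 * (\<bar>\<alpha> x\<bar> + norm (\<beta> x))" for x
      have "continuous_on {- R..R} h"
        unfolding h_def by (intro continuous_intros continuous_on_subset[OF cont(1)] continuous_on_subset[OF cont(2)]) auto
      then have "bounded (h ` {- R..R})"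
        by (intro compact_imp_bounded compact_continuous_image compact_Icc)
      then obtain C where C: "\<And>x. x \<in> {- R..R} \<Longrightarrow> \<bar>h x\<bar> \<le> C"
        unfolding bounded_iff by (metis imageI real_norm_def)
      have "norm (f' x, g' x) \<le> C * norm (f x, g x)" if "\<bar>x\<bar> \<le> R" for x
      proof -
        have n: "norm (f x) \<le> norm (f x, g x)" "norm (g x) \<le> norm (f x, g x)"
          using norm_fst_le[of "f x" "g x"] norm_snd_le[of "g x" "f x"] by auto
        have "norm (f' x) \<le> \<bar>\<alpha> x\<bar> * norm (f x) + norm (\<beta> x) * norm (g x)"
          unfolding f'_def by (simp add: norm_mult) (metis norm_mult norm_of_real norm_triangle_ineq)
        moreover have "norm (g' x) \<le> norm (\<beta> x) * norm (f x) + \<bar>\<alpha> x\<bar> * norm (g x)"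
          unfolding g'_def by (simp add: norm_mult) (metis complex_mod_cnj norm_mult norm_of_real norm_triangle_ineq)
        moreover have "\<bar>\<alpha> x\<bar> * norm (f x) \<le> \<bar>\<alpha> x\<bar> * norm (f x, g x)"
          "norm (\<beta> x) * norm (g x) \<le> norm (\<beta> x) * norm (f x, g x)"
          "\<bar>\<alpha> x\<bar> * norm (g x) \<le> \<bar>\<alpha> x\<bar> * norm (f x, g x)"
          "norm (\<beta> x) * norm (f x) \<le> norm (\<beta> x) * norm (f x, g x)"
          using n by (auto intro: mult_left_mono)
        moreover have "norm (f' x, g' x) \<le> norm (f' x) + norm (g' x)"
          by (rule norm_Pair_le)
        ultimately have "norm (f' x, g' x) \<le> h x * norm (f x, g x)"
          unfolding h_def by (simp add: algebra_simps)
        also have "\<dots> \<le> C * norm (f x, g x)"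
          using C[of x] that by (intro mult_right_mono) (auto simp: abs_le_iff)
        finally show ?thesis .
      qed
      then show ?thesis by blast
    qed
    show "(f x0, g x0) = 0" using zero by (simp add: zero_prod_def)
  qed
  then show ?thesis by (simp add: zero_prod_def)
qed

text \<open>The coefficient matrix is trace free, so by Liouville's formula the determinant of two
  solutions is constant.\<close>

lemma dirac_wronskian_constant:
  assumes "dirac_solution \<alpha> \<beta> f1 g1" "dirac_solution \<alpha> \<beta> f2 g2"
  shows "f1 x * g2 x - g1 x * f2 x = f1 0 * g2 0 - g1 0 * f2 0"
proof -
  have "((\<lambda>x. f1 x * g2 x - g1 x * f2 x) has_vector_derivative 0) (at x)" for x
  proof -
    note d = assms[unfolded dirac_solution_def, rule_format, of x]
    show ?thesis
      using has_vector_derivative_diff[OF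
          has_vector_derivative_mult[OF d(1)[THEN conjunct1] d(2)[THEN conjunct2]]
          has_vector_derivative_mult[OF d(1)[THEN conjunct2] d(2)[THEN conjunct1]]]
      by (simp add: algebra_simps)
  qed
  then show ?thesis
    using has_vector_derivative_zero_constant[of UNIV "\<lambda>x. f1 x * g2 x - g1 x * f2 x"]
    by (metis UNIV_I convex_UNIV has_vector_derivative_at_within)
qed

text \<open>The Wronskian of a square integrable and a bounded solution is constant and comes
  arbitrarily close to zero.\<close>

lemma dirac_square_integrable_proportional:
  assumes sol: "dirac_solution \<alpha> \<beta> f g" "dirac_solution \<alpha> \<beta> p q"
    and cont: "continuous_on UNIV \<alpha>" "continuous_on UNIV \<beta>"
    and sq: "square_integrable f" "square_integrable g"
    and bd: "\<And>x. norm (p x) \<le> C" "\<And>x. norm (q x) \<le> C"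
    and nz: "p x0 \<noteq> 0 \<or> q x0 \<noteq> 0"
  shows "\<exists>c. \<forall>x. f x = c * p x \<and> g x = c * q x"
proof -
  have C: "C > 0"
    using nz bd by (metis norm_le_zero_iff not_le order_trans)
  have wr0: "f x * q x - g x * p x = 0" for x
  proof (rule ccontr)
    assume *: "f x * q x - g x * p x \<noteq> 0"
    define d where "d = norm (f x * q x - g x * p x) / C"
    have d: "d > 0" using * C by (simp add: d_def)
    \<comment> \<open>The sum of both moduli is a single square integrable function, so both
      components are small at a common point.\<close>
    let ?h = "\<lambda>y. complex_of_real (norm (f y)) + of_real (norm (g y))"
    have "square_integrable (\<lambda>y. of_real (norm (f y)) :: complex)"
      "square_integrable (\<lambda>y. of_real (norm (g y)) :: complex)"
      using sq unfolding square_integrable_def by auto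
    then have "square_integrable ?h" by (rule square_integrable_add)
    then obtain y where y: "norm (?h y) < d"
      using square_integrable_not_bounded_below[of ?h d 0] d by auto
    have "norm (f x * q x - g x * p x) = norm (f y * q y - g y * p y)"
      using dirac_wronskian_constant[OF sol, of x] dirac_wronskian_constant[OF sol, of y] by simp
    also have "\<dots> \<le> norm (f y) * norm (q y) + norm (g y) * norm (p y)"
      by (metis norm_mult norm_triangle_ineq4)
    also have "\<dots> \<le> norm (f y) * C + norm (g y) * C"
      using bd by (intro add_mono mult_left_mono) auto
    also have "\<dots> = norm (?h y) * C"
      by (simp add: algebra_simps flip: of_real_add)
    also have "\<dots> < d * C" using y C by simp
    also have "\<dots> = norm (f x * q x - g x * p x)" using C by (simp add: d_def)
    finally show False by simp
  qed
  \<comment> \<open>The vanishing determinant makes the two vectors at \<open>x0\<close> parallel;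
    uniqueness then extends the factor \<open>c\<close> to the whole line.\<close>
  obtain c where c: "f x0 = c * p x0" "g x0 = c * q x0"
  proof (cases "p x0 = 0")
    case True
    with nz wr0[of x0] that[of "g x0 / q x0"] show ?thesis by auto
  next
    case False
    with wr0[of x0] that[of "f x0 / p x0"] show ?thesis by (auto simp: field_simps)
  qed
  have "f x - c * p x = 0 \<and> g x - c * q x = 0" for x
    by (rule dirac_solution_unique[OF dirac_solution_diff_mult[OF sol] cont, where ?x0.0 = x0])
       (use c in auto)
  then show ?thesis by auto
qed

text \<open>The coefficient matrix squares to \<open>(1 - \<omega>\<^sup>2) I\<close>; with \<open>k\<^sup>2 = 1 - \<omega>\<^sup>2\<close>, each component \<open>y\<close> of a
  solution makes \<open>y' + k y\<close> and \<open>y' - k y\<close> exponentials.\<close>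

lemma constant_dirac_not_square_integrable:
  assumes sol: "dirac_solution (\<lambda>x. \<omega>) (\<lambda>x. of_real s) f g" and s: "s\<^sup>2 = 1"
    and sq: "square_integrable f" "square_integrable g"
  shows "f x = 0 \<and> g x = 0"
proof -
  \<comment> \<open>The complex root also covers \<open>\<bar>\<omega>\<bar> > 1\<close>, where
    \<open>k\<close> is imaginary.\<close>
  define k where "k = csqrt (1 - (of_real \<omega>)\<^sup>2)"
  have k2: "k\<^sup>2 = 1 - (of_real \<omega>)\<^sup>2" by (simp add: k_def)
  have s2: "complex_of_real s * of_real s = 1"
    using s by (simp flip: of_real_mult add: power2_eq_square)
  define f' where "f' x = - \<i> * (of_real \<omega> * f x + of_real s * g x)" for x
  define g' where "g' x = \<i> * (of_real s * f x + of_real \<omega> * g x)" for x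
  have df: "(f has_vector_derivative f' x) (at x)" and dg: "(g has_vector_derivative g' x) (at x)" for x
    using sol by (simp_all add: dirac_solution_def f'_def g'_def)
  have sqm: "square_integrable (\<lambda>x. c * h x)" if "square_integrable h" for c :: complex and h
    using square_integrable_bounded_linear[OF that bounded_linear_mult_right[of c]] .
  have sq': "square_integrable f'" "square_integrable g'"
    unfolding f'_def g'_def by (intro sqm square_integrable_add sq)+
  have df': "(f' has_vector_derivative k\<^sup>2 * f x) (at x)" for x
  proof -
    have "(f' has_vector_derivative - \<i> * (of_real \<omega> * f' x + of_real s * g' x)) (at x)"
      unfolding f'_def[abs_def]
      by (intro has_vector_derivative_mult_right has_vector_derivative_add df[unfolded f'_def] dg[unfolded g'_def] | simp add: g'_def)+
    moreover have "- \<i> * (of_real \<omega> * f' x + of_real s * g' x) = k\<^sup>2 * f x"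
    proof -
      have "- \<i> * (of_real \<omega> * f' x + of_real s * g' x)
          = (of_real s * of_real s - (of_real \<omega>)\<^sup>2) * f x"
        by (simp add: f'_def g'_def algebra_simps power2_eq_square)
      then show ?thesis by (simp add: s2 k2)
    qed
    ultimately show ?thesis by simp
  qed
  have dg': "(g' has_vector_derivative k\<^sup>2 * g x) (at x)" for x
  proof -
    have "(g' has_vector_derivative \<i> * (of_real s * f' x + of_real \<omega> * g' x)) (at x)"
      unfolding g'_def[abs_def]
      by (intro has_vector_derivative_mult_right has_vector_derivative_add df dg[unfolded g'_def])
    moreover have "\<i> * (of_real s * f' x + of_real \<omega> * g' x) = k\<^sup>2 * g x"
    proof -
      have "\<i> * (of_real s * f' x + of_real \<omega> * g' x)
          = (of_real s * of_real s - (of_real \<omega>)\<^sup>2) * g x"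
        by (simp add: f'_def g'_def algebra_simps power2_eq_square)
      then show ?thesis by (simp add: s2 k2)
    qed
    ultimately show ?thesis by simp
  qed
  have vanish: "y x = 0"
    if dy: "\<And>x. (y has_vector_derivative y' x) (at x)"
      and dy': "\<And>x. (y' has_vector_derivative k\<^sup>2 * y x) (at x)"
      and sqy: "square_integrable y" "square_integrable y'" for y y' x
  proof -
    have *: "y' x + l * y x = 0" if l: "l\<^sup>2 = k\<^sup>2" for l x
    proof (rule exponential_ode_not_square_integrable[where k = l])
      show "((\<lambda>x. y' x + l * y x) has_vector_derivative l * (y' x + l * y x)) (at x)" for x
        using has_vector_derivative_add[OF dy' has_vector_derivative_mult_right[OF dy, of l], of x]
        unfolding l[symmetric] by (simp add: algebra_simps power2_eq_square)
      show "square_integrable (\<lambda>x. y' x + l * y x)"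
        by (intro square_integrable_add sqm sqy)
    qed
    \<comment> \<open>Adding the identities for \<open>k\<close> and \<open>- k\<close> removes
      \<open>y\<close>, also in the degenerate case \<open>k = 0\<close>. So \<open>y\<close> is
      constant, an exponential with exponent zero.\<close>
    have "y' x = 0" for x using *[of k x] *[of "- k" x] by simp
    then show ?thesis
      using exponential_ode_not_square_integrable[of y 0 x] dy sqy(1) by simp
  qed
  show ?thesis
    using vanish[OF df df' sq(1) sq'(1)] vanish[OF dg dg' sq(2) sq'(2)] by blast
qed

section \<open>Second derivatives and symmetries of the potential\<close>

text \<open>Two applications of the mean value theorem, first along \<open>h\<close> and then along
  \<open>k\<close>, turn the quotient into a value of \<open>f''\<close> near \<open>z\<close>. The
  quotient is symmetric in \<open>h\<close> and \<open>k\<close>, and it recovers \<open>f''\<close>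
  from growth bounds on \<open>f\<close> alone.\<close>

lemma mixed_difference_quotient:
  fixes f :: "'a::real_normed_vector \<Rightarrow> real" and f' :: "'a \<Rightarrow> 'a \<Rightarrow>\<^sub>L real"
  assumes G: "open G" "z \<in> G"
    and df: "\<And>y. y \<in> G \<Longrightarrow> (f has_derivative blinfun_apply (f' y)) (at y)"
    and ddf: "\<And>y. y \<in> G \<Longrightarrow> (f' has_derivative blinfun_apply (f'' y)) (at y)"
    and cont: "continuous_on G f''"
  shows "((\<lambda>t. (f (z + t *\<^sub>R h + t *\<^sub>R k) - f (z + t *\<^sub>R h) - f (z + t *\<^sub>R k) + f z) / t\<^sup>2)
           \<longlongrightarrow> f'' z k h) (at_right 0)"
proof (rule tendstoI)
  fix e :: real assume e: "e > 0"
  have "continuous_on G (\<lambda>y. f'' y k h)"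
    by (intro continuous_intros cont)
  then have "\<forall>\<^sub>F y in at z. dist (f'' y k h) (f'' z k h) < e"
    using G e unfolding continuous_on_eq_continuous_at[OF G(1)] continuous_at by (metis tendstoD)
  moreover have "\<forall>\<^sub>F y in at z. y \<in> G" using G by (simp add: eventually_at_in_open')
  ultimately have "\<forall>\<^sub>F y in at z. y \<in> G \<and> dist (f'' y k h) (f'' z k h) < e"
    by eventually_elim simp
  then obtain d where d: "d > 0"
    and near: "\<And>y. dist y z < d \<Longrightarrow> y \<in> G \<and> dist (f'' y k h) (f'' z k h) < e"
    unfolding eventually_at using G(2) e by (metis UNIV_I dist_self)
  \<comment> \<open>For \<open>t < d / M\<close> the parallelogram spanned at \<open>z\<close> by
    the \<open>t\<close>-multiples of \<open>h\<close> and \<open>k\<close> stays within distance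
    \<open>d\<close> of \<open>z\<close>; the summand 1 keeps \<open>M\<close> positive.\<close>
  define M where "M = norm h + norm k + 1"
  have M: "M > 0" unfolding M_def by (smt (verit) norm_ge_zero)
  show "\<forall>\<^sub>F t in at_right 0. dist ((f (z + t *\<^sub>R h + t *\<^sub>R k) - f (z + t *\<^sub>R h)
      - f (z + t *\<^sub>R k) + f z) / t\<^sup>2) (f'' z k h) < e"
    unfolding eventually_at_right_field
  proof (intro exI conjI allI impI)
    show "0 < d / M" using d M by simp
    fix t :: real assume t: "0 < t" "t < d / M"
    have tM: "t * M < d" using t M by (simp add: field_simps)
    have near': "dist (z + s *\<^sub>R h + r *\<^sub>R k) z < d" if "0 \<le> s" "s \<le> t" "0 \<le> r" "r \<le> t" for s r
    proof -
      have "dist (z + s *\<^sub>R h + r *\<^sub>R k) z \<le> s * norm h + r * norm k"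
        using norm_triangle_ineq[of "s *\<^sub>R h" "r *\<^sub>R k"] that by (simp add: dist_norm algebra_simps)
      also have "\<dots> \<le> t * norm h + t * norm k"
        using that by (intro add_mono mult_right_mono) auto
      also have "\<dots> \<le> t * M" using t by (simp add: M_def algebra_simps)
      finally show ?thesis using tM by simp
    qed
    have inG: "z + s *\<^sub>R h + r *\<^sub>R k \<in> G" if "0 \<le> s" "s \<le> t" "0 \<le> r" "r \<le> t" for s r
      using near near' that by blast
    have dh: "((\<lambda>s. f (z + s *\<^sub>R h + r *\<^sub>R k)) has_real_derivative f' (z + s *\<^sub>R h + r *\<^sub>R k) h) (at s)"
      if "0 \<le> s" "s \<le> t" "0 \<le> r" "r \<le> t" for s r
    proof -
      have "((\<lambda>s. z + s *\<^sub>R h + r *\<^sub>R k) has_derivative (\<lambda>s. s *\<^sub>R h)) (at s)"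
        by (auto intro!: derivative_eq_intros)
      from has_derivative_compose[OF this df[OF inG[OF that]]] show ?thesis
        by (simp add: has_field_derivative_def blinfun.scaleR_right mult.commute[of _ "f' _ _"])
    qed
    have dk: "((\<lambda>r. f' (z + s *\<^sub>R h + r *\<^sub>R k) h) has_real_derivative f'' (z + s *\<^sub>R h + r *\<^sub>R k) k h) (at r)"
      if "0 \<le> s" "s \<le> t" "0 \<le> r" "r \<le> t" for s r
    proof -
      have "((\<lambda>r. z + s *\<^sub>R h + r *\<^sub>R k) has_derivative (\<lambda>r. r *\<^sub>R k)) (at r)"
        by (auto intro!: derivative_eq_intros)
      from has_derivative_compose[OF this ddf[OF inG[OF that]]]
      have "((\<lambda>r. f' (z + s *\<^sub>R h + r *\<^sub>R k) h) has_derivative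
          (\<lambda>x. f'' (z + s *\<^sub>R h + r *\<^sub>R k) (x *\<^sub>R k) h)) (at r)"
        by (rule bounded_linear.has_derivative[OF blinfun.bounded_linear_left])
      then show ?thesis
        by (simp add: has_field_derivative_def blinfun.scaleR_right blinfun.scaleR_left
            mult.commute[of _ "f'' _ _ _"])
    qed
    \<comment> \<open>The mean value theorem along \<open>h\<close>, applied to the difference of
      \<open>f\<close> on the two opposite sides of the parallelogram.\<close>
    obtain s where s: "0 < s" "s < t"
      and eq1: "(f (z + t *\<^sub>R h + t *\<^sub>R k) - f (z + t *\<^sub>R h + 0 *\<^sub>R k))
           - (f (z + 0 *\<^sub>R h + t *\<^sub>R k) - f (z + 0 *\<^sub>R h + 0 *\<^sub>R k))
         = (t - 0) * (f' (z + s *\<^sub>R h + t *\<^sub>R k) h - f' (z + s *\<^sub>R h + 0 *\<^sub>R k) h)"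
      using MVT2[of 0 t "\<lambda>s. f (z + s *\<^sub>R h + t *\<^sub>R k) - f (z + s *\<^sub>R h + 0 *\<^sub>R k)"
          "\<lambda>s. f' (z + s *\<^sub>R h + t *\<^sub>R k) h - f' (z + s *\<^sub>R h + 0 *\<^sub>R k) h"]
        DERIV_diff[OF dh[of _ t] dh[of _ 0]] t by auto
    obtain r where r: "0 < r" "r < t"
      and eq2: "f' (z + s *\<^sub>R h + t *\<^sub>R k) h - f' (z + s *\<^sub>R h + 0 *\<^sub>R k) h
         = (t - 0) * f'' (z + s *\<^sub>R h + r *\<^sub>R k) k h"
      using MVT2[OF t(1) dk[of s]] s by auto
    have "(f (z + t *\<^sub>R h + t *\<^sub>R k) - f (z + t *\<^sub>R h) - f (z + t *\<^sub>R k) + f z) / t\<^sup>2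
        = f'' (z + s *\<^sub>R h + r *\<^sub>R k) k h"
      using eq1 eq2 t by (simp add: field_simps power2_eq_square)
    then show "dist ((f (z + t *\<^sub>R h + t *\<^sub>R k) - f (z + t *\<^sub>R h)
        - f (z + t *\<^sub>R k) + f z) / t\<^sup>2) (f'' z k h) < e"
      using near near' s r by auto
  qed
qed

text \<open>The mixed difference quotient does not change when \<open>h\<close> and \<open>k\<close>
  are exchanged, and limits are unique.\<close>

lemma second_derivative_symmetric:
  fixes f :: "'a::real_normed_vector \<Rightarrow> real" and f' :: "'a \<Rightarrow> 'a \<Rightarrow>\<^sub>L real"
  assumes "open G" "z \<in> G"
    and "\<And>y. y \<in> G \<Longrightarrow> (f has_derivative blinfun_apply (f' y)) (at y)"
    and "\<And>y. y \<in> G \<Longrightarrow> (f' has_derivative blinfun_apply (f'' y)) (at y)"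
    and "continuous_on G f''"
  shows "f'' z h k = f'' z k h"
  using mixed_difference_quotient[OF assms, of h k] mixed_difference_quotient[OF assms, of k h]
  by (intro tendsto_unique[OF trivial_limit_at_right_real, rotated]) (simp_all add: algebra_simps)

section \<open>Wirtinger derivatives from the Frechet derivative\<close>

definition wirt_u :: "(complex \<times> complex \<Rightarrow> complex) \<Rightarrow> complex" where
  "wirt_u \<phi> = (\<phi> (1, 0) - \<i> * \<phi> (\<i>, 0)) / 2"

definition wirt_ubar :: "(complex \<times> complex \<Rightarrow> complex) \<Rightarrow> complex" where
  "wirt_ubar \<phi> = (\<phi> (1, 0) + \<i> * \<phi> (\<i>, 0)) / 2"

definition wirt_v :: "(complex \<times> complex \<Rightarrow> complex) \<Rightarrow> complex" where
  "wirt_v \<phi> = (\<phi> (0, 1) - \<i> * \<phi> (0, \<i>)) / 2"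

definition wirt_vbar :: "(complex \<times> complex \<Rightarrow> complex) \<Rightarrow> complex" where
  "wirt_vbar \<phi> = (\<phi> (0, 1) + \<i> * \<phi> (0, \<i>)) / 2"

lemmas wirt_defs = wirt_u_def wirt_ubar_def wirt_v_def wirt_vbar_def

lemma has_derivative_along_line:
  assumes "(g has_derivative g') (at z)"
  shows "((\<lambda>t. g (z + t *\<^sub>R k)) has_vector_derivative g' k) (at 0)"
proof -
  have "((\<lambda>t::real. z + t *\<^sub>R k) has_derivative (\<lambda>t. t *\<^sub>R k)) (at 0)"
    by (auto intro!: derivative_eq_intros)
  from has_derivative_compose[OF this, of g g'] assms
  have "((\<lambda>t. g (z + t *\<^sub>R k)) has_derivative (\<lambda>t. g' (t *\<^sub>R k))) (at 0)"
    by simp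
  then show ?thesis
    using linear_scale[OF has_derivative_linear[OF assms]]
    by (simp add: has_vector_derivative_def)
qed

text \<open>The real partial derivatives are the values of \<open>g'\<close> on the directions
  \<open>1\<close> and \<open>\<i>\<close> of each variable, so the Wirtinger derivatives are fixed
  complex combinations of these values.\<close>

lemma wirtinger_eq:
  assumes "(g has_derivative g') (at z)"
  shows "d_u g z = wirt_u g'" "d_ubar g z = wirt_ubar g'"
    "d_v g z = wirt_v g'" "d_vbar g z = wirt_vbar g'"
proof -
  obtain u v where z: "z = (u, v)" by (cases z)
  have l: "vector_derivative (\<lambda>t. g (z + t *\<^sub>R k)) (at 0) = g' k" for k
    by (rule vector_derivative_at[OF has_derivative_along_line[OF assms]])
  have "vector_derivative (\<lambda>t. g (u + of_real t, v)) (at 0) = g' (1, 0)"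
    "vector_derivative (\<lambda>t. g (u + \<i> * of_real t, v)) (at 0) = g' (\<i>, 0)"
    "vector_derivative (\<lambda>t. g (u, v + of_real t)) (at 0) = g' (0, 1)"
    "vector_derivative (\<lambda>t. g (u, v + \<i> * of_real t)) (at 0) = g' (0, \<i>)"
    using l[of "(1, 0)"] l[of "(\<i>, 0)"] l[of "(0, 1)"] l[of "(0, \<i>)"]
    by (simp_all add: z scaleR_conv_of_real mult.commute)
  then show "d_u g z = wirt_u g'" "d_ubar g z = wirt_ubar g'"
    "d_v g z = wirt_v g'" "d_vbar g z = wirt_vbar g'"
    by (simp_all add: z d_u_def d_ubar_def d_v_def d_vbar_def wirt_defs)
qed

section \<open>Invariance of the potential under the reflection\<close>

definition reflect :: "complex \<times> complex \<Rightarrow> complex \<times> complex" where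
  "reflect z = (cnj (snd z), cnj (fst z))"

lemma reflect_simps [simp]: "reflect (a, b) = (cnj b, cnj a)"
  by (simp add: reflect_def)

lemma bounded_linear_reflect: "bounded_linear reflect"
  unfolding reflect_def
  by (intro bounded_linear_Pair bounded_linear_compose[OF bounded_linear_cnj] bounded_linear_fst bounded_linear_snd)

locale potential =
  fixes W :: "complex \<times> complex \<Rightarrow> real" and G :: "(complex \<times> complex) set"
    and DW :: "complex \<times> complex \<Rightarrow> (complex \<times> complex) \<Rightarrow>\<^sub>L real"
    and DDW :: "complex \<times> complex \<Rightarrow> (complex \<times> complex) \<Rightarrow>\<^sub>L ((complex \<times> complex) \<Rightarrow>\<^sub>L real)"
  assumes gauge: "gauge_invariant W" and swap: "swap_symmetric W" and conj: "conj_symmetric W"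
    and open_G: "open G"
    and DW: "\<And>z. z \<in> G \<Longrightarrow> (W has_derivative blinfun_apply (DW z)) (at z)"
    and DDW: "\<And>z. z \<in> G \<Longrightarrow> (DW has_derivative blinfun_apply (DDW z)) (at z)"
    and continuous_DDW: "continuous_on G DDW"
begin

lemma DDW_sym: "z \<in> G \<Longrightarrow> DDW z h k = DDW z k h"
  by (rule second_derivative_symmetric[OF open_G _ DW DDW continuous_DDW])

lemma DDW_apply: "z \<in> G \<Longrightarrow> ((\<lambda>y. DW y k) has_derivative (\<lambda>h. DDW z h k)) (at z)"
  by (rule bounded_linear.has_derivative[OF blinfun.bounded_linear_left DDW])

lemma d_W:
  assumes "z \<in> G"
  shows "d_u (\<lambda>z. of_real (W z)) z = wirt_u (\<lambda>k. of_real (DW z k))"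
    "d_ubar (\<lambda>z. of_real (W z)) z = wirt_ubar (\<lambda>k. of_real (DW z k))"
    "d_v (\<lambda>z. of_real (W z)) z = wirt_v (\<lambda>k. of_real (DW z k))"
    "d_vbar (\<lambda>z. of_real (W z)) z = wirt_vbar (\<lambda>k. of_real (DW z k))"
  by (rule wirtinger_eq has_derivative_of_real DW assms)+

text \<open>The formulas for the first Wirtinger derivatives hold on the whole open set, so they may
  be differentiated once more; \<open>h\<close> is the direction of this second
  differentiation.\<close>

lemma dd_W:
  assumes z: "z \<in> G"
  shows "(d_u (\<lambda>z. of_real (W z)) has_derivative (\<lambda>h. wirt_u (\<lambda>k. of_real (DDW z h k)))) (at z)"
    "(d_ubar (\<lambda>z. of_real (W z)) has_derivative (\<lambda>h. wirt_ubar (\<lambda>k. of_real (DDW z h k)))) (at z)"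
    "(d_v (\<lambda>z. of_real (W z)) has_derivative (\<lambda>h. wirt_v (\<lambda>k. of_real (DDW z h k)))) (at z)"
    "(d_vbar (\<lambda>z. of_real (W z)) has_derivative (\<lambda>h. wirt_vbar (\<lambda>k. of_real (DDW z h k)))) (at z)"
proof -
  have comb: "((\<lambda>y. (of_real (DW y a) + c * of_real (DW y b)) / 2) has_derivative
      (\<lambda>h. (of_real (DDW z h a) + c * of_real (DDW z h b)) / 2)) (at z)" for a b and c :: complex
    by (intro bounded_linear.has_derivative[OF bounded_linear_divide] has_derivative_add
        has_derivative_mult_right has_derivative_of_real DDW_apply z)
  note transform = has_derivative_transform_within_open[OF _ open_G z d_W(1)[symmetric]]
    has_derivative_transform_within_open[OF _ open_G z d_W(2)[symmetric]]
    has_derivative_transform_within_open[OF _ open_G z d_W(3)[symmetric]]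
    has_derivative_transform_within_open[OF _ open_G z d_W(4)[symmetric]]
  show "(d_u (\<lambda>z. of_real (W z)) has_derivative (\<lambda>h. wirt_u (\<lambda>k. of_real (DDW z h k)))) (at z)"
    by (rule transform(1)) (use comb[of "(1, 0)" "- \<i>" "(\<i>, 0)"] in \<open>simp_all add: wirt_defs\<close>)
  show "(d_ubar (\<lambda>z. of_real (W z)) has_derivative (\<lambda>h. wirt_ubar (\<lambda>k. of_real (DDW z h k)))) (at z)"
    by (rule transform(2)) (use comb[of "(1, 0)" \<i> "(\<i>, 0)"] in \<open>simp_all add: wirt_defs\<close>)
  show "(d_v (\<lambda>z. of_real (W z)) has_derivative (\<lambda>h. wirt_v (\<lambda>k. of_real (DDW z h k)))) (at z)"
    by (rule transform(3)) (use comb[of "(0, 1)" "- \<i>" "(0, \<i>)"] in \<open>simp_all add: wirt_defs\<close>)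
  show "(d_vbar (\<lambda>z. of_real (W z)) has_derivative (\<lambda>h. wirt_vbar (\<lambda>k. of_real (DDW z h k)))) (at z)"
    by (rule transform(4)) (use comb[of "(0, 1)" \<i> "(0, \<i>)"] in \<open>simp_all add: wirt_defs\<close>)
qed

lemma W_reflect: "W (reflect z) = W z"
  using conj swap unfolding conj_symmetric_def swap_symmetric_def reflect_def
  by (metis prod.collapse)

lemma DW_reflect:
  assumes "z \<in> G" "reflect z \<in> G"
  shows "DW (reflect z) (reflect k) = DW z k"
proof -
  have "((\<lambda>y. W (reflect y)) has_derivative (\<lambda>k. DW (reflect z) (reflect k))) (at z)"
    using has_derivative_compose[OF bounded_linear_imp_has_derivative[OF bounded_linear_reflect] DW[OF assms(2)]] .
  then show ?thesis
    using has_derivative_unique[OF _ DW[OF assms(1)]] unfolding W_reflect by metis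
qed

text \<open>\<open>DW_reflect\<close> is differentiated with \<open>k\<close> held fixed; since
  \<open>z\<close> is a fixed point, both Hessians are taken at the same point.\<close>

lemma DDW_reflect:
  assumes z: "z \<in> G" "reflect z = z"
  shows "DDW z (reflect h) (reflect k) = DDW z h k"
proof -
  \<comment> \<open>\<open>DW_reflect\<close> needs a point and its image in \<open>G\<close>; this
    is an open neighbourhood of \<open>z\<close> where both lie there.\<close>
  define G' where "G' = G \<inter> reflect -` G"
  have G': "open G'" "z \<in> G'"
    unfolding G'_def
    using open_G z open_vimage[OF open_G linear_continuous_on[OF bounded_linear_reflect]] by auto
  have "((\<lambda>y. DW (reflect y) (reflect k)) has_derivative (\<lambda>h. DDW (reflect z) (reflect h) (reflect k))) (at z)"
    using has_derivative_compose[OF bounded_linear_imp_has_derivative[OF bounded_linear_reflect] DDW_apply] z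
    by metis
  then have "((\<lambda>y. DW y k) has_derivative (\<lambda>h. DDW (reflect z) (reflect h) (reflect k))) (at z)"
    by (rule has_derivative_transform_within_open[OF _ G']) (auto simp: G'_def intro: DW_reflect)
  then show ?thesis
    using has_derivative_unique[OF _ DDW_apply[OF z(1)]] z(2) by metis
qed

section \<open>Infinitesimal gauge invariance\<close>

definition rot :: "complex \<times> complex \<Rightarrow> complex \<times> complex" where
  "rot z = (\<i> * fst z, \<i> * snd z)"

text \<open>\<open>rot z\<close> is the tangent at \<open>\<alpha> = 0\<close> of the gauge orbit of
  \<open>z\<close>, along which \<open>W\<close> is constant.\<close>

lemma DW_gauge:
  assumes z: "z \<in> G"
  shows "DW z (rot z) = 0"
proof -
  have "((\<lambda>\<alpha>. (cis \<alpha> * fst z, cis \<alpha> * snd z)) has_vector_derivative rot z) (at 0)"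
    unfolding rot_def
    by (intro has_vector_derivative_Pair has_vector_derivative_mult_left)
       (auto simp: has_vector_derivative_def intro!: derivative_eq_intros)
  then have "((\<lambda>\<alpha>. (cis \<alpha> * fst z, cis \<alpha> * snd z)) has_derivative (\<lambda>t. t *\<^sub>R rot z)) (at 0)"
    by (simp add: has_vector_derivative_def)
  from has_derivative_compose[OF this, of W "DW z"] DW[OF z]
  have "((\<lambda>\<alpha>. W (cis \<alpha> * fst z, cis \<alpha> * snd z)) has_derivative (\<lambda>t. DW z (t *\<^sub>R rot z))) (at 0)"
    by simp
  then have "((\<lambda>\<alpha>. W z) has_derivative (\<lambda>t. DW z (t *\<^sub>R rot z))) (at (0::real))"
    using gauge unfolding gauge_invariant_def by simp
  from has_derivative_unique[OF this has_derivative_const] show ?thesis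
    by (metis scaleR_one)
qed

text \<open>The product rule applied to the identity of \<open>DW_gauge\<close>. It expresses the
  gradient through the Hessian in the gauge direction.\<close>

lemma DDW_gauge:
  assumes z: "z \<in> G"
  shows "DDW z h (rot z) = - DW z (rot h)"
proof -
  have "bounded_linear rot"
    unfolding rot_def
    by (intro bounded_linear_Pair bounded_linear_compose[OF bounded_linear_mult_right] bounded_linear_fst bounded_linear_snd)
  then have "((\<lambda>y. DW y (rot y)) has_derivative (\<lambda>h. DW z (rot h) + DDW z h (rot z))) (at z)"
    by (intro blinfun.FDERIV DDW z bounded_linear_imp_has_derivative)
  moreover have "((\<lambda>y. DW y (rot y)) has_derivative (\<lambda>h. 0)) (at z)"
    by (rule has_derivative_transform_within_open[OF has_derivative_const[of 0] open_G z]) (simp add: DW_gauge)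
  ultimately have "(\<lambda>h. DW z (rot h) + DDW z h (rot z)) = (\<lambda>h. 0)"
    by (rule has_derivative_unique)
  then show ?thesis by (metis add_eq_0_iff add.commute)
qed

end

section \<open>Block diagonalization\<close>

lemma vector_2_eq_iff: "x = y \<longleftrightarrow> x $ 1 = y $ 1 \<and> x $ 2 = y $ 2" for x y :: "'a ^ 2"
  by (simp add: vec_eq_iff forall_2)

lemma vector_2_axis: "vector [a, b] = axis 1 a + (axis 2 b :: 'a::monoid_add ^ 2)"
  by (simp add: vector_2_eq_iff axis_def)

lemma bounded_linear_axis: "bounded_linear (axis i :: 'a::euclidean_space \<Rightarrow> 'a ^ 'n)"
  unfolding linear_conv_bounded_linear[symmetric]
  by (auto intro!: linearI simp: vec_eq_iff axis_def)

lemma vector_4_eq_iff: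
  "x = y \<longleftrightarrow> x $ 1 = y $ 1 \<and> x $ 2 = y $ 2 \<and> x $ 3 = y $ 3 \<and> x $ 4 = y $ 4" for x y :: "'a ^ 4"
  by (simp add: vec_eq_iff forall_4)

lemma matrix_vector_mult_2: "(M *v x) $ i = M $ i $ 1 * x $ 1 + M $ i $ 2 * x $ 2"
  for M :: "'a::semiring_1 ^ 2 ^ 'n"
  by (simp add: matrix_vector_mult_def sum_2)

lemma matrix_vector_mult_4:
  "(M *v x) $ i = M $ i $ 1 * x $ 1 + M $ i $ 2 * x $ 2 + M $ i $ 3 * x $ 3 + M $ i $ 4 * x $ 4"
  for M :: "'a::semiring_1 ^ 4 ^ 'n"
  by (simp add: matrix_vector_mult_def sum_4)

lemma sigma3_mult [simp]: "(sigma3 *v y) $ 1 = y $ 1" "(sigma3 *v y) $ 2 = - y $ 2"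
  by (simp_all add: sigma3_def matrix_vector_mult_2)

lemma sigma3_sigma3 [simp]: "sigma3 *v (sigma3 *v y) = y"
  by (simp add: vector_2_eq_iff)

lemma sigma_mult [simp]:
  "(sigma *v y) $ 1 = y $ 1" "(sigma *v y) $ 2 = - y $ 2"
  "(sigma *v y) $ 3 = y $ 3" "(sigma *v y) $ 4 = - y $ 4"
  by (simp_all add: sigma_def matrix_vector_mult_4)

section \<open>The orthogonal matrix S and the splitting into two blocks\<close>

definition r2 :: complex where "r2 = of_real (1 / sqrt 2)"

lemma r2_r2: "r2 * r2 = 1 / 2"
proof -
  have "r2 * r2 = of_real ((1 / sqrt 2) * (1 / sqrt 2))" by (simp only: of_real_mult r2_def)
  then show ?thesis by simp
qed

lemma r2_half: "r2 * (r2 * c) = c / 2" "r2 * (2 * r2) = 1"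
  by (simp_all add: r2_r2 mult.left_commute[of r2 2] mult.assoc[of r2 r2, symmetric])

lemma S_matrix_component: "S_matrix $ i $ j = r2 *
    (vector [vector [1, 0, 1, 0], vector [0, 1, 0, 1],
             vector [0, 1, 0, - 1], vector [1, 0, - 1, 0]] :: complex ^ 4 ^ 4) $ i $ j"
  by (simp add: S_matrix_def r2_def)

lemma matrix_inv_unique:
  fixes A :: "'a::semiring_1 ^ 'n ^ 'm"
  assumes "A ** B = mat 1" "B ** A = mat 1"
  shows "matrix_inv A = B"
proof -
  have "A ** matrix_inv A = mat 1 \<and> matrix_inv A ** A = mat 1"
    unfolding matrix_inv_def by (rule someI[of _ B]) (simp add: assms)
  then show ?thesis
    using assms by (metis matrix_mul_assoc matrix_mul_lid matrix_mul_rid)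
qed

lemma S_matrix_inv: "matrix_inv S_matrix = transpose S_matrix"
  by (rule matrix_inv_unique)
     (simp_all add: vector_4_eq_iff matrix_matrix_mult_def sum_4 transpose_def mat_def
        S_matrix_component r2_r2)

lemma V_parts:
  "V1_part U $ 1 = r2 * (U $ 1 + U $ 4)" "V1_part U $ 2 = r2 * (U $ 2 + U $ 3)"
  "V2_part U $ 1 = r2 * (U $ 1 - U $ 4)" "V2_part U $ 2 = r2 * (U $ 2 - U $ 3)"
  by (simp_all add: V1_part_def V2_part_def S_matrix_inv matrix_vector_mult_4 transpose_def
      S_matrix_component algebra_simps)

text \<open>Multiplication by \<open>S_matrix\<close> of the vector with blocks \<open>a\<close> and
  \<open>b\<close>, hence the inverse of the splitting into \<open>V1_part\<close> and
  \<open>V2_part\<close>.\<close>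

definition join_parts :: "complex ^ 2 \<Rightarrow> complex ^ 2 \<Rightarrow> complex ^ 4" where
  "join_parts a b = vector [r2 * (a $ 1 + b $ 1), r2 * (a $ 2 + b $ 2),
     r2 * (a $ 2 - b $ 2), r2 * (a $ 1 - b $ 1)]"

lemma parts_join [simp]: "V1_part (join_parts a b) = a" "V2_part (join_parts a b) = b"
  by (simp_all add: vector_2_eq_iff V_parts join_parts_def distrib_left right_diff_distrib r2_half)

lemma join_parts_eq: "join_parts (V1_part U) (V2_part U) = U"
  by (simp add: vector_4_eq_iff V_parts join_parts_def distrib_left right_diff_distrib r2_half)

lemma parts_eq_iff: "U = U' \<longleftrightarrow> V1_part U = V1_part U' \<and> V2_part U = V2_part U'"
  by (metis join_parts_eq)

text \<open>\<open>sigma\<close> has opposite signs at positions 1 and 4, and at 2 and 3, so it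
  turns the sums in \<open>V1_part\<close> into the differences in \<open>V2_part\<close> and
  conversely. This exchange couples the two blocks and produces the products of operators.\<close>

lemma parts_sigma:
  "V1_part (c *s (sigma *v U)) = c *s (sigma3 *v V2_part U)"
  "V2_part (c *s (sigma *v U)) = c *s (sigma3 *v V1_part U)"
  by (simp_all add: vector_2_eq_iff V_parts algebra_simps)

lemma bounded_linear_parts: "bounded_linear V1_part" "bounded_linear V2_part"
  unfolding linear_conv_bounded_linear[symmetric]
  by (auto intro!: linearI simp: vector_2_eq_iff V_parts algebra_simps)

lemma bounded_linear_join: "bounded_linear (\<lambda>a. join_parts a 0)" "bounded_linear (join_parts 0)"
  unfolding linear_conv_bounded_linear[symmetric]
  by (auto intro!: linearI simp: vector_4_eq_iff join_parts_def algebra_simps)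

lemma join_parts_add: "join_parts a b = join_parts a 0 + join_parts 0 b"
  by (simp add: vector_4_eq_iff join_parts_def algebra_simps)

context potential
begin

text \<open>At points fixed by \<open>reflect\<close>, \<open>coef_a\<close> to
  \<open>coef_d\<close> are the derivatives \<open>d_ubar d_u\<close>, \<open>d_ubar d_vbar\<close>,
  \<open>d_ubar d_ubar\<close> and \<open>d_ubar d_v\<close> of \<open>W\<close>, written in real
  Hessian entries.\<close>

definition coef_a :: "complex \<times> complex \<Rightarrow> real" where
  "coef_a z = (DDW z (1, 0) (1, 0) + DDW z (\<i>, 0) (\<i>, 0)) / 4"

definition coef_b :: "complex \<times> complex \<Rightarrow> real" where
  "coef_b z = (DDW z (1, 0) (0, 1) - DDW z (\<i>, 0) (0, \<i>)) / 4"

definition coef_c :: "complex \<times> complex \<Rightarrow> complex" where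
  "coef_c z = Complex (DDW z (1, 0) (1, 0) - DDW z (\<i>, 0) (\<i>, 0)) (2 * DDW z (1, 0) (\<i>, 0)) / 4"

definition coef_d :: "complex \<times> complex \<Rightarrow> complex" where
  "coef_d z = Complex (DDW z (1, 0) (0, 1) + DDW z (\<i>, 0) (0, \<i>)) (2 * DDW z (\<i>, 0) (0, 1)) / 4"

lemmas coef_defs = coef_a_def coef_b_def coef_c_def coef_d_def

text \<open>Symmetry and reflection invariance reduce the sixteen real Hessian entries to six; the
  equations are oriented as rewrite rules towards these.\<close>

lemma DDW_basis:
  assumes z: "z \<in> G" "reflect z = z"
  shows "DDW z (0, 1) (0, 1) = DDW z (1, 0) (1, 0)" "DDW z (0, \<i>) (0, \<i>) = DDW z (\<i>, 0) (\<i>, 0)"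
    "DDW z (\<i>, 0) (1, 0) = DDW z (1, 0) (\<i>, 0)"
    "DDW z (0, 1) (0, \<i>) = - DDW z (1, 0) (\<i>, 0)" "DDW z (0, \<i>) (0, 1) = - DDW z (1, 0) (\<i>, 0)"
    "DDW z (1, 0) (0, \<i>) = - DDW z (\<i>, 0) (0, 1)" "DDW z (0, \<i>) (1, 0) = - DDW z (\<i>, 0) (0, 1)"
    "DDW z (0, 1) (1, 0) = DDW z (1, 0) (0, 1)" "DDW z (0, \<i>) (\<i>, 0) = DDW z (\<i>, 0) (0, \<i>)"
    "DDW z (0, 1) (\<i>, 0) = DDW z (\<i>, 0) (0, 1)"
proof -
  \<comment> \<open>Conjugation reverses imaginary directions; writing the images as negatives lets
    the sign be pulled out of \<open>DDW\<close>.\<close>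
  have r: "reflect (0, \<i>) = - (\<i>, 0)" "reflect (\<i>, 0) = - (0, \<i>)" "reflect (1, 0) = (0, 1)" "reflect (0, 1) = (1, 0)"
    by simp_all
  note R = DDW_reflect[OF z] and S = DDW_sym[OF z(1)]
  note m = r blinfun.minus_right blinfun.minus_left minus_minus
  show "DDW z (0, 1) (0, 1) = DDW z (1, 0) (1, 0)" using R[of "(1, 0)" "(1, 0)"] unfolding m by simp
  show "DDW z (0, \<i>) (0, \<i>) = DDW z (\<i>, 0) (\<i>, 0)" using R[of "(\<i>, 0)" "(\<i>, 0)"] unfolding m by simp
  show "DDW z (\<i>, 0) (1, 0) = DDW z (1, 0) (\<i>, 0)" by (rule S)
  show 1: "DDW z (0, 1) (0, \<i>) = - DDW z (1, 0) (\<i>, 0)" using R[of "(1, 0)" "(\<i>, 0)"] unfolding m by simp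
  show "DDW z (0, \<i>) (0, 1) = - DDW z (1, 0) (\<i>, 0)" using 1 S by metis
  show 2: "DDW z (1, 0) (0, \<i>) = - DDW z (\<i>, 0) (0, 1)"
    using R[of "(1, 0)" "(0, \<i>)"] S[of "(0, 1)" "(\<i>, 0)"] unfolding m by simp
  show "DDW z (0, \<i>) (1, 0) = - DDW z (\<i>, 0) (0, 1)" using 2 S by metis
  show "DDW z (0, 1) (1, 0) = DDW z (1, 0) (0, 1)" by (rule S)
  show "DDW z (0, \<i>) (\<i>, 0) = DDW z (\<i>, 0) (0, \<i>)" by (rule S)
  show "DDW z (0, 1) (\<i>, 0) = DDW z (\<i>, 0) (0, 1)" by (rule S)
qed

text \<open>The entries of \<open>V_matrix\<close> take only four values up to conjugation. This
  repetition is what makes sums and differences of rows decouple.\<close>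

lemma second_wirtinger:
  assumes z: "z \<in> G" "reflect z = z"
  defines "w \<equiv> \<lambda>z. complex_of_real (W z)"
  shows "d_ubar (d_u w) z = of_real (coef_a z)" "d_u (d_ubar w) z = of_real (coef_a z)"
    "d_vbar (d_v w) z = of_real (coef_a z)" "d_v (d_vbar w) z = of_real (coef_a z)"
    "d_ubar (d_vbar w) z = of_real (coef_b z)" "d_vbar (d_ubar w) z = of_real (coef_b z)"
    "d_u (d_v w) z = of_real (coef_b z)" "d_v (d_u w) z = of_real (coef_b z)"
    "d_ubar (d_ubar w) z = coef_c z" "d_v (d_v w) z = coef_c z"
    "d_u (d_u w) z = cnj (coef_c z)" "d_vbar (d_vbar w) z = cnj (coef_c z)"
    "d_ubar (d_v w) z = coef_d z" "d_v (d_ubar w) z = coef_d z"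
    "d_u (d_vbar w) z = cnj (coef_d z)" "d_vbar (d_u w) z = cnj (coef_d z)"
  unfolding w_def
    wirtinger_eq[OF dd_W(1)[OF z(1)]] wirtinger_eq[OF dd_W(2)[OF z(1)]]
    wirtinger_eq[OF dd_W(3)[OF z(1)]] wirtinger_eq[OF dd_W(4)[OF z(1)]]
  by (simp_all add: wirt_defs DDW_basis[OF z] coef_defs complex_eq_iff field_simps)

definition pot_alpha :: "real \<Rightarrow> complex \<times> complex \<Rightarrow> real" where
  "pot_alpha s z = coef_a z + s * coef_b z"

text \<open>The full off-diagonal entry of \<open>H_sign\<close>: the constant \<open>- s\<close> is
  absorbed here, whereas \<open>\<omega>\<close> is added to \<open>pot_alpha\<close>
  separately.\<close>

definition pot_beta :: "real \<Rightarrow> complex \<times> complex \<Rightarrow> complex" where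
  "pot_beta s z = coef_c z + of_real s * coef_d z - of_real s"

lemma H_sign_eq:
  fixes s \<omega> :: real
  assumes z: "(u0 x, v0 x) \<in> G" "reflect (u0 x, v0 x) = (u0 x, v0 x)"
  defines "\<alpha> \<equiv> \<omega> + pot_alpha s (u0 x, v0 x)" and "\<beta> \<equiv> pot_beta s (u0 x, v0 x)"
  shows "H_sign (of_real s) W \<omega> u0 v0 V V' x = vector
     [of_real \<alpha> * V x $ 1 + \<beta> * V x $ 2 - \<i> * V' x $ 1,
      cnj \<beta> * V x $ 1 + of_real \<alpha> * V x $ 2 + \<i> * V' x $ 2]"
  unfolding vector_2_eq_iff H_sign_def V_sign_matrix_def Let_def vector_add_component
    matrix_vector_mult_2 vector_2 second_wirtinger[OF z] \<alpha>_def \<beta>_def pot_alpha_def pot_beta_def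
  by (simp add: algebra_simps)

text \<open>Rows 1 and 4 of \<open>H_omega\<close> carry the derivative with the same sign, as do
  rows 2 and 3, and the second derivatives repeat as in \<open>second_wirtinger\<close>. So the sums
  of these rows involve only \<open>V1_part\<close>, the differences only
  \<open>V2_part\<close>.\<close>

lemma H_omega_parts:
  assumes z: "(u0 x, v0 x) \<in> G" "reflect (u0 x, v0 x) = (u0 x, v0 x)"
  shows "V1_part (H_omega W \<omega> u0 v0 U U' x)
      = H_plus W \<omega> u0 v0 (\<lambda>x. V1_part (U x)) (\<lambda>x. V1_part (U' x)) x"
    "V2_part (H_omega W \<omega> u0 v0 U U' x)
      = H_minus W \<omega> u0 v0 (\<lambda>x. V2_part (U x)) (\<lambda>x. V2_part (U' x)) x"
  unfolding vector_2_eq_iff H_sign_def H_omega_def V_sign_matrix_def V_matrix_def Let_def vector_add_component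
    matrix_vector_mult_2 matrix_vector_mult_4 vector_2 vector_4 second_wirtinger[OF z] V_parts
  by (simp_all add: algebra_simps)

end

section \<open>Solutions generated by the stationary solution\<close>

lemma complex_pair_basis:
  "(a, b) = Re a *\<^sub>R (1, 0) + Im a *\<^sub>R (\<i>, 0) + Re b *\<^sub>R (0, 1) + Im b *\<^sub>R (0, \<i>)"
  by (simp add: complex_eq_iff)

text \<open>As \<open>\<alpha>\<close> is real, the second equation is the conjugate of the
  first.\<close>

lemma dirac_solution_cnj:
  assumes "\<And>x. (f has_vector_derivative - \<i> * (of_real (\<alpha> x) * f x + \<beta> x * cnj (f x))) (at x)"
  shows "dirac_solution \<alpha> \<beta> f (\<lambda>x. cnj (f x))"
  unfolding dirac_solution_def
proof (intro allI conjI assms)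
  show "((\<lambda>x. cnj (f x)) has_vector_derivative \<i> * (cnj (\<beta> x) * f x + of_real (\<alpha> x) * cnj (f x))) (at x)" for x
    using bounded_linear.has_vector_derivative[OF bounded_linear_cnj assms, of x] by (simp add: algebra_simps)
qed

locale stationary_potential = potential +
  fixes \<omega> :: real and u0 :: "real \<Rightarrow> complex"
  assumes in_G: "\<And>x. (u0 x, cnj (u0 x)) \<in> G" and zero_in_G: "(0, 0) \<in> G"
    and stationary: "stationary_solution W \<omega> u0 (\<lambda>x. cnj (u0 x))"
    and decay: "(u0 \<longlongrightarrow> 0) at_infinity"
    and order4: "analytic_order4 W"
begin

definition z0 :: "real \<Rightarrow> complex \<times> complex" where "z0 x = (u0 x, cnj (u0 x))"

definition force :: "real \<Rightarrow> complex" where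
  "force x = wirt_ubar (\<lambda>k. of_real (DW (z0 x) k))"

text \<open>The derivative dictated by the stationary equation; the explicit formula can itself be
  differentiated through \<open>force\<close>.\<close>

definition u0' :: "real \<Rightarrow> complex" where
  "u0' x = - \<i> * (of_real \<omega> * u0 x - cnj (u0 x) + force x)"

abbreviation alpha :: "real \<Rightarrow> real \<Rightarrow> real" where
  "alpha s \<equiv> \<lambda>x. \<omega> + pot_alpha s (z0 x)"

abbreviation beta :: "real \<Rightarrow> real \<Rightarrow> complex" where
  "beta s \<equiv> \<lambda>x. pot_beta s (z0 x)"

abbreviation Hs :: "real \<Rightarrow> 2 diff_expr" where
  "Hs s \<equiv> H_sign (of_real s) W \<omega> u0 (\<lambda>x. cnj (u0 x))"

lemma z0_in_G [simp]: "z0 x \<in> G"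
  by (simp add: z0_def in_G)

lemma reflect_z0 [simp]: "reflect (z0 x) = z0 x"
  by (simp add: z0_def)

lemma u0_deriv: "(u0 has_vector_derivative u0' x) (at x)"
proof -
  obtain u' where u': "(u0 has_vector_derivative u') (at x)"
    and eq: "\<i> * u' = of_real \<omega> * u0 x - cnj (u0 x) + d_ubar (\<lambda>z. of_real (W z)) (u0 x, cnj (u0 x))"
    using stationary unfolding stationary_solution_def by blast
  have "\<i> * u' = of_real \<omega> * u0 x - cnj (u0 x) + force x"
    unfolding eq force_def z0_def d_W(2)[OF in_G] ..
  then have "u' = u0' x"
    unfolding u0'_def by (auto dest: arg_cong[where f = "\<lambda>w. - \<i> * w"] simp flip: mult.assoc)
  with u' show ?thesis by simp
qed

lemma cnj_u0_deriv: "((\<lambda>x. cnj (u0 x)) has_vector_derivative cnj (u0' x)) (at x)"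
  by (rule bounded_linear.has_vector_derivative[OF bounded_linear_cnj u0_deriv])

lemma z0_deriv: "(z0 has_vector_derivative (u0' x, cnj (u0' x))) (at x)"
  unfolding z0_def[abs_def]
  by (intro has_vector_derivative_Pair u0_deriv cnj_u0_deriv)

lemma continuous_u0: "continuous_on A u0"
  using u0_deriv by (meson continuous_at_imp_continuous_on has_vector_derivative_continuous)

lemma continuous_z0: "continuous_on A z0"
  unfolding z0_def[abs_def] by (intro continuous_intros continuous_u0)

lemma continuous_DDW_z0: "continuous_on A (\<lambda>x. DDW (z0 x) h k)"
  by (intro continuous_intros continuous_on_compose2[OF continuous_DDW continuous_z0]) auto

lemma continuous_alpha: "continuous_on A (alpha s)"
  unfolding pot_alpha_def coef_defs by (intro continuous_intros continuous_DDW_z0) auto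

lemma continuous_beta: "continuous_on A (beta s)"
  unfolding pot_beta_def coef_defs Complex_eq
  by (intro continuous_on_add continuous_on_diff continuous_on_mult continuous_on_divide
      continuous_on_of_real continuous_on_const continuous_DDW_z0) auto

lemma Hs_eq: "Hs s V V' x = vector
     [of_real (alpha s x) * V x $ 1 + beta s x * V x $ 2 - \<i> * V' x $ 1,
      cnj (beta s x) * V x $ 1 + of_real (alpha s x) * V x $ 2 + \<i> * V' x $ 2]"
  using H_sign_eq[of u0 x "\<lambda>x. cnj (u0 x)" s \<omega> V V'] z0_in_G[of x] reflect_z0[of x]
  unfolding z0_def by simp

text \<open>Reflection invariance at a fixed point identifies the \<open>v\<close>-directions with
  the \<open>u\<close>-directions, up to the sign of the imaginary one.\<close>

lemma DW_z0: "DW (z0 x) (a, b) = (Re a + Re b) * DW (z0 x) (1, 0) + (Im a - Im b) * DW (z0 x) (\<i>, 0)"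
proof -
  have "DW (z0 x) (0, 1) = DW (z0 x) (1, 0)" "DW (z0 x) (0, \<i>) = - DW (z0 x) (\<i>, 0)"
    using DW_reflect[of "z0 x" "(1, 0)"] DW_reflect[of "z0 x" "- (\<i>, 0)"]
    by (simp_all del: uminus_Pair add: blinfun.minus_right) (simp_all add: blinfun.minus_right)
  then show ?thesis
    unfolding complex_pair_basis[of a b] blinfun.add_right blinfun.scaleR_right
    by (simp add: algebra_simps)
qed

text \<open>\<open>DDW_gauge\<close> writes each gradient component as a Hessian entry with one
  direction \<open>rot (z0 x)\<close>. The nonlinear term thus becomes linear in \<open>u0\<close>
  and its conjugate, with the coefficients of \<open>H_minus\<close>.\<close>

lemma force_gauge:
  "force x = of_real (pot_alpha (- 1) (z0 x)) * u0 x - (pot_beta (- 1) (z0 x) - 1) * cnj (u0 x)"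
proof -
  have r: "rot (z0 x) = (- Im (u0 x)) *\<^sub>R (1, 0) + Re (u0 x) *\<^sub>R (\<i>, 0) + Im (u0 x) *\<^sub>R (0, 1) + Re (u0 x) *\<^sub>R (0, \<i>)"
    by (simp add: rot_def z0_def complex_eq_iff)
  \<comment> \<open>\<open>rot\<close> maps \<open>(1, 0)\<close> to \<open>(\<i>, 0)\<close> and
    \<open>(\<i>, 0)\<close> to \<open>- (1, 0)\<close>, which accounts for the signs.\<close>
  have h: "DW (z0 x) (\<i>, 0) = - DDW (z0 x) (1, 0) (rot (z0 x))" "DW (z0 x) (1, 0) = DDW (z0 x) (\<i>, 0) (rot (z0 x))"
    using blinfun.minus_right[of "DW (z0 x)" "(1, 0)"] by (simp_all add: DDW_gauge) (simp_all add: rot_def)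
  show ?thesis
    unfolding force_def wirt_ubar_def h r
    by (simp only: blinfun.add_right blinfun.scaleR_right DDW_basis[OF z0_in_G reflect_z0])
       (simp add: complex_eq_iff pot_alpha_def pot_beta_def coef_defs field_simps)
qed

text \<open>Chain rule along \<open>z0\<close>: the second component of the velocity is the
  conjugate of the first, so the Wirtinger coefficients combine to those of \<open>H_plus\<close>.
  The \<open>+ 1\<close> undoes the constant inside \<open>pot_beta 1\<close>.\<close>

lemma force_deriv:
  "(force has_vector_derivative of_real (pot_alpha 1 (z0 x)) * u0' x + (pot_beta 1 (z0 x) + 1) * cnj (u0' x)) (at x)"
proof -
  have e: "(u0' x, cnj (u0' x)) = Re (u0' x) *\<^sub>R (1, 0) + Im (u0' x) *\<^sub>R (\<i>, 0) + Re (u0' x) *\<^sub>R (0, 1) + (- Im (u0' x)) *\<^sub>R (0, \<i>)"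
    unfolding complex_pair_basis[of "u0' x"] by simp
  have D: "((\<lambda>x. DW (z0 x) k) has_real_derivative DDW (z0 x) (u0' x, cnj (u0' x)) k) (at x)" for k
    using has_derivative_compose[OF z0_deriv[unfolded has_vector_derivative_def] DDW_apply[OF z0_in_G]]
    unfolding has_real_derivative_iff_has_vector_derivative has_vector_derivative_def blinfun.scaleR_right blinfun.scaleR_left .
  have "(force has_vector_derivative wirt_ubar (\<lambda>k. of_real (DDW (z0 x) (u0' x, cnj (u0' x)) k))) (at x)"
    unfolding force_def[abs_def] wirt_ubar_def
    by (intro has_vector_derivative_divide has_vector_derivative_add has_vector_derivative_mult_right
        has_vector_derivative_of_real D)
  also have "wirt_ubar (\<lambda>k. of_real (DDW (z0 x) (u0' x, cnj (u0' x)) k))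
      = of_real (pot_alpha 1 (z0 x)) * u0' x + (pot_beta 1 (z0 x) + 1) * cnj (u0' x)"
    unfolding e wirt_ubar_def
    by (simp only: blinfun.add_left blinfun.scaleR_left blinfun.add_right blinfun.scaleR_right
        plus_blinfun.rep_eq scaleR_blinfun.rep_eq DDW_basis[OF z0_in_G reflect_z0])
       (simp add: complex_eq_iff pot_alpha_def pot_beta_def coef_defs field_simps)
  finally show ?thesis .
qed

text \<open>\<open>\<i> * u0\<close> is the infinitesimal gauge rotation; with
  \<open>force_gauge\<close> the stationary equation itself becomes this linear system.\<close>

lemma u0_solution: "dirac_solution (alpha (- 1)) (beta (- 1)) (\<lambda>x. \<i> * u0 x) (\<lambda>x. cnj (\<i> * u0 x))"
proof (rule dirac_solution_cnj)
  fix x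
  have "- \<i> * (of_real (alpha (- 1) x) * (\<i> * u0 x) + beta (- 1) x * cnj (\<i> * u0 x)) = \<i> * u0' x"
    by (simp add: u0'_def force_gauge algebra_simps)
  then show "((\<lambda>x. \<i> * u0 x) has_vector_derivative
      - \<i> * (of_real (alpha (- 1) x) * (\<i> * u0 x) + beta (- 1) x * cnj (\<i> * u0 x))) (at x)"
    using has_vector_derivative_mult_right[OF u0_deriv, of \<i>] by metis
qed

text \<open>Infinitesimal translation: the stationary equation is differentiated in
  \<open>x\<close>, with \<open>force_deriv\<close> for the nonlinear term.\<close>

lemma u0'_solution: "dirac_solution (alpha 1) (beta 1) u0' (\<lambda>x. cnj (u0' x))"
proof (rule dirac_solution_cnj)
  fix x
  have "((\<lambda>x. - \<i> * (of_real \<omega> * u0 x - cnj (u0 x) + force x)) has_vector_derivative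
     - \<i> * (of_real \<omega> * u0' x - cnj (u0' x)
       + (of_real (pot_alpha 1 (z0 x)) * u0' x + (pot_beta 1 (z0 x) + 1) * cnj (u0' x)))) (at x)"
    by (intro has_vector_derivative_mult_right has_vector_derivative_add has_vector_derivative_diff
        u0_deriv cnj_u0_deriv force_deriv)
  then show "(u0' has_vector_derivative
      - \<i> * (of_real (alpha 1 x) * u0' x + beta 1 x * cnj (u0' x))) (at x)"
    unfolding u0'_def[abs_def, symmetric] by (simp add: algebra_simps)
qed

text \<open>Coefficients, right-hand side and solution are continuous, so \<open>V'\<close> agrees
  almost everywhere with a continuous function and the equation holds at every point.\<close>

lemma applies_Hs_deriv:
  assumes "applies (Hs s) V h" "continuous_on UNIV h"
  shows "((\<lambda>x. V x $ 1) has_vector_derivative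
      - \<i> * (of_real (alpha s x) * V x $ 1 + beta s x * V x $ 2 - h x $ 1)) (at x)"
    "((\<lambda>x. V x $ 2) has_vector_derivative
      \<i> * (cnj (beta s x) * V x $ 1 + of_real (alpha s x) * V x $ 2 - h x $ 2)) (at x)"
proof -
  obtain V' where ac: "ac_derivative V V'" and ae: "AE x in lborel. Hs s V V' x = h x"
    using assms(1) unfolding applies_def by blast
  have bl: "bounded_linear (\<lambda>y::complex ^ 2. y $ i)" for i by (rule bounded_linear_vec_nth)
  have acn: "ac_derivative (\<lambda>x. V x $ i) (\<lambda>x. V' x $ i)" for i
    by (rule ac_derivative_bounded_linear[OF ac bl])
  have cV: "continuous_on UNIV (\<lambda>x. V x $ i)" "continuous_on UNIV (\<lambda>x. h x $ i)" for i
    by (intro continuous_intros ac_derivative_continuous[OF ac] assms(2))+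
  have i_eq: "a - \<i> * b = c \<longleftrightarrow> b = - \<i> * (a - c)" "a + \<i> * b = c \<longleftrightarrow> b = \<i> * (a - c)" for a b c
    by (auto simp: algebra_simps complex_eq_iff)
  show "((\<lambda>x. V x $ 1) has_vector_derivative
      - \<i> * (of_real (alpha s x) * V x $ 1 + beta s x * V x $ 2 - h x $ 1)) (at x)"
  proof (rule ac_derivative_has_vector_derivative[OF acn])
    show "AE x in lborel. V' x $ 1 = - \<i> * (of_real (alpha s x) * V x $ 1 + beta s x * V x $ 2 - h x $ 1)"
      using ae by eventually_elim (simp only: Hs_eq vector_2_eq_iff vector_2 i_eq)
  qed (intro continuous_intros continuous_alpha continuous_beta cV)
  show "((\<lambda>x. V x $ 2) has_vector_derivative
      \<i> * (cnj (beta s x) * V x $ 1 + of_real (alpha s x) * V x $ 2 - h x $ 2)) (at x)"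
  proof (rule ac_derivative_has_vector_derivative[OF acn])
    show "AE x in lborel. V' x $ 2 = \<i> * (cnj (beta s x) * V x $ 1 + of_real (alpha s x) * V x $ 2 - h x $ 2)"
      using ae by eventually_elim (simp only: Hs_eq vector_2_eq_iff vector_2 i_eq)
  qed (intro continuous_intros continuous_alpha continuous_beta cV)
qed

lemma applies_Hs_zero_dirac:
  assumes "applies (Hs s) V (\<lambda>x. 0)"
  shows "dirac_solution (alpha s) (beta s) (\<lambda>x. V x $ 1) (\<lambda>x. V x $ 2)"
  using applies_Hs_deriv[OF assms continuous_on_const] by (simp add: dirac_solution_def)

lemma dirac_applies_Hs_zero:
  assumes sol: "dirac_solution (alpha s) (beta s) f g"
  shows "applies (Hs s) (\<lambda>x. vector [f x, g x]) (\<lambda>x. 0)"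
proof -
  define f' where "f' x = - \<i> * (of_real (alpha s x) * f x + beta s x * g x)" for x
  define g' where "g' x = \<i> * (cnj (beta s x) * f x + of_real (alpha s x) * g x)" for x
  have d: "(f has_vector_derivative f' x) (at x)" "(g has_vector_derivative g' x) (at x)" for x
    using sol by (simp_all add: dirac_solution_def f'_def g'_def)
  have c: "continuous_on UNIV f" "continuous_on UNIV g"
    using d by (meson continuous_at_imp_continuous_on has_vector_derivative_continuous)+
  have "ac_derivative (\<lambda>x. vector [f x, g x] :: complex ^ 2) (\<lambda>x. vector [f' x, g' x])"
  proof (rule ac_derivativeI)
    show "((\<lambda>x. vector [f x, g x] :: complex ^ 2) has_vector_derivative vector [f' x, g' x]) (at x)" for x
      unfolding vector_2_axis
      by (intro has_vector_derivative_add bounded_linear.has_vector_derivative[OF bounded_linear_axis] d)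
    have "continuous_on UNIV f'" "continuous_on UNIV g'"
      unfolding f'_def g'_def by (intro continuous_intros continuous_alpha continuous_beta c)+
    then show "continuous_on UNIV (\<lambda>x. vector [f' x, g' x] :: complex ^ 2)"
      unfolding vector_2_axis by (intro continuous_on_add bounded_linear.continuous_on[OF bounded_linear_axis])
  qed
  moreover have "Hs s (\<lambda>x. vector [f x, g x]) (\<lambda>x. vector [f' x, g' x]) x = 0" for x
    unfolding Hs_eq vector_2_eq_iff by (simp add: f'_def g'_def algebra_simps)
  ultimately show ?thesis unfolding applies_def by blast
qed

end

section \<open>The potential near the origin and the energy of the stationary solution\<close>

text \<open>Absolute convergence at one point with positive coordinates controls all coefficients at
  once. Passing from radius \<open>\<rho>\<close> to \<open>t\<close> shrinks a term of degree at
  least four by the factor \<open>(t / \<rho>) ^ 4\<close> or more, and lower degrees are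
  absent.\<close>

lemma analytic_order4_bound:
  assumes "analytic_order4 W"
  shows "\<exists>C r. r > 0 \<and> (\<forall>z. norm z < r \<longrightarrow> \<bar>W z\<bar> \<le> C * norm z ^ 4)"
proof -
  obtain c :: "nat \<times> nat \<times> nat \<times> nat \<Rightarrow> complex" and r
    where cr: "r > 0 \<and> (\<forall>j k l m. j + k + l + m < 4 \<longrightarrow> c (j, k, l, m) = 0) \<and>
        (\<forall>u v. norm u < r \<and> norm v < r \<longrightarrow>
           ((\<lambda>(j, k, l, m). c (j, k, l, m) * u ^ j * cnj u ^ k * v ^ l * cnj v ^ m)
              has_sum of_real (W (u, v))) UNIV)"
    using assms unfolding analytic_order4_def by (elim exE) (rule that)
  then have r: "r > 0" and c0: "\<And>j k l m. j + k + l + m < 4 \<Longrightarrow> c (j, k, l, m) = 0"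
    by auto
  from cr have sums: "((\<lambda>(j, k, l, m). c (j, k, l, m) * u ^ j * cnj u ^ k * v ^ l * cnj v ^ m)
              has_sum of_real (W (u, v))) UNIV" if "norm u < r" "norm v < r" for u v
    using that by auto
  \<comment> \<open>Strictly inside the region of convergence, so that the series may be evaluated
    at the point with both coordinates \<open>\<rho>\<close>.\<close>
  define \<rho> where "\<rho> = r / 2"
  have \<rho>: "0 < \<rho>" "\<rho> < r" using r by (simp_all add: \<rho>_def)
  define g where "g = (\<lambda>(j, k, l, m). norm (c (j, k, l, m)) * \<rho> ^ (j + k + l + m))"
  define f where "f = (\<lambda>(j, k, l, m). c (j, k, l, m) * of_real \<rho> ^ j * cnj (of_real \<rho>) ^ k
      * of_real \<rho> ^ l * cnj (of_real \<rho>) ^ m)"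
  have "f summable_on UNIV"
    using sums[of "of_real \<rho>" "of_real \<rho>"] \<rho> by (auto simp: summable_on_def f_def)
  then have "(\<lambda>p. norm (f p)) summable_on UNIV"
    by (simp add: summable_on_iff_abs_summable_on_complex)
  moreover have "(\<lambda>p. norm (f p)) = g"
    using \<rho> by (auto simp: f_def g_def norm_mult norm_power power_add)
  ultimately have "g summable_on UNIV" by simp
  then obtain S where S: "(g has_sum S) UNIV" by (auto simp: summable_on_def)
  have "\<bar>W z\<bar> \<le> S / \<rho> ^ 4 * norm z ^ 4" if z: "norm z < \<rho>" for z
  proof -
    obtain u v where uv: "z = (u, v)" by (cases z)
    define t where "t = norm z"
    have n: "norm u \<le> t" "norm v \<le> t"
      using norm_fst_le[of u v] norm_snd_le[of v u] by (auto simp: uv t_def)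
    have t: "0 \<le> t" "t < \<rho>" using z by (auto simp: t_def)
    have "norm (complex_of_real (W (u, v))) \<le> (t / \<rho>) ^ 4 * S"
    proof (rule norm_infsum_le[OF sums has_sum_cmult_right[OF S]])
      show "norm u < r" "norm v < r" using n t \<rho> by auto
      show "norm (case p of (j, k, l, m) \<Rightarrow> c (j, k, l, m) * u ^ j * cnj u ^ k * v ^ l * cnj v ^ m)
          \<le> (t / \<rho>) ^ 4 * g p" for p
      proof -
        obtain j k l m where p: "p = (j, k, l, m)" by (cases p)
        define N where "N = j + k + l + m"
        show ?thesis
        proof (cases "N < 4")
          case True
          then show ?thesis using c0 by (simp add: p N_def g_def)
        next
          case False
          have "norm (c (j, k, l, m) * u ^ j * cnj u ^ k * v ^ l * cnj v ^ m)
              = norm (c (j, k, l, m)) * (norm u ^ j * norm u ^ k * norm v ^ l * norm v ^ m)"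
            by (simp add: norm_mult norm_power)
          also have "\<dots> \<le> norm (c (j, k, l, m)) * (t ^ j * t ^ k * t ^ l * t ^ m)"
            using n t by (intro mult_left_mono mult_mono power_mono) auto
          also have "t ^ j * t ^ k * t ^ l * t ^ m = t ^ N"
            by (simp add: N_def power_add)
          also have "t ^ N = (t / \<rho>) ^ N * \<rho> ^ N"
            using \<rho> by (simp add: power_divide)
          also have "norm (c (j, k, l, m)) * ((t / \<rho>) ^ N * \<rho> ^ N)
              \<le> norm (c (j, k, l, m)) * ((t / \<rho>) ^ 4 * \<rho> ^ N)"
            using t \<rho> False by (intro mult_left_mono mult_right_mono power_decreasing) auto
          finally show ?thesis by (simp add: p g_def N_def mult_ac)
        qed
      qed
    qed
    then show ?thesis by (simp add: uv t_def power_divide mult_ac)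
  qed
  with \<rho>(1) show ?thesis by blast
qed

text \<open>Monotone convergence along the exhausting intervals, whose integrals are uniformly
  bounded.\<close>

lemma square_integrableI_bounded_integrals:
  fixes f :: "real \<Rightarrow> 'a::euclidean_space"
  assumes cont: "continuous_on UNIV f"
    and bound: "\<And>n::nat. integral {- real n..real n} (\<lambda>x. (norm (f x))\<^sup>2) \<le> M"
  shows "square_integrable f"
  unfolding square_integrable_def
proof
  have meas: "f \<in> borel_measurable borel"
    by (rule borel_measurable_continuous_onI[OF cont])
  then show "f \<in> borel_measurable lborel" by simp
  define g where "g n x = indicator {- real n..real n} x * (norm (f x))\<^sup>2" for n x
  have si: "set_integrable lborel {- real n..real n} (\<lambda>x. (norm (f x))\<^sup>2)" for n
    by (intro borel_integrable_atLeastAtMost' continuous_intros continuous_on_subset[OF cont]) auto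
  have int: "integrable lborel (g n)" for n
    using si[of n] by (simp add: set_integrable_def g_def[abs_def])
  have eq: "(\<integral>x. g n x \<partial>lborel) = integral {- real n..real n} (\<lambda>x. (norm (f x))\<^sup>2)" for n
    using set_borel_integral_eq_integral(2)[OF si[of n]]
    by (simp add: set_lebesgue_integral_def g_def)
  have mono: "g n x \<le> g m x" if "n \<le> m" for n m x
    using that by (auto simp: g_def indicator_def)
  have inc: "incseq (\<lambda>n. \<integral>x. g n x \<partial>lborel)"
    by (intro incseq_def[THEN iffD2] allI impI integral_mono int mono)
  obtain L where L: "(\<lambda>n. \<integral>x. g n x \<partial>lborel) \<longlonglongrightarrow> L"
    using incseq_convergent[OF inc] bound unfolding eq by metis
  show "integrable lborel (\<lambda>x. (norm (f x))\<^sup>2)"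
  proof (rule integrable_monotone_convergence[OF int _ _ L])
    show "AE x in lborel. mono (\<lambda>n. g n x)" using mono by (auto simp: mono_def)
    show "AE x in lborel. (\<lambda>n. g n x) \<longlonglongrightarrow> (norm (f x))\<^sup>2"
    proof (intro AE_I2 tendsto_eventually)
      fix x
      show "\<forall>\<^sub>F n in sequentially. g n x = (norm (f x))\<^sup>2"
        using eventually_ge_at_top[of "nat \<lceil>\<bar>x\<bar>\<rceil>"]
        by eventually_elim (auto simp: g_def indicator_def abs_le_iff nat_le_iff ceiling_le_iff)
    qed
    show "(\<lambda>x. (norm (f x))\<^sup>2) \<in> borel_measurable lborel" using meas by measurable
  qed
qed

context stationary_potential
begin

text \<open>The fourth order bound makes every mixed difference quotient at the origin tend to zero,
  which identifies the Hessian without differentiating the series.\<close>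

lemma DW_zero: "DW 0 = 0" and DDW_zero: "DDW 0 = 0" and W_zero: "W 0 = 0"
proof -
  obtain C r where r: "r > 0" and bd: "\<And>z. norm z < r \<Longrightarrow> \<bar>W z\<bar> \<le> C * norm z ^ 4"
    using analytic_order4_bound[OF order4] by blast
  have z: "0 \<in> G" using zero_in_G by (simp add: zero_prod_def)
  show W0: "W 0 = 0" using bd[of 0] r by simp
  have quot: "((\<lambda>t. W (t *\<^sub>R a) / t\<^sup>2) \<longlongrightarrow> 0) (at_right 0)" for a
  proof (rule Lim_null_comparison)
    have "((\<lambda>t. norm (t *\<^sub>R a)) \<longlongrightarrow> norm (0 *\<^sub>R a)) (at_right 0)"
      by (intro tendsto_intros)
    then have "\<forall>\<^sub>F t in at_right 0. norm (t *\<^sub>R a) < r"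
      using r by (intro order_tendstoD) auto
    moreover have "\<forall>\<^sub>F t in at_right (0::real). t > 0" by (simp add: eventually_at_right_less)
    ultimately show "\<forall>\<^sub>F t in at_right 0. norm (W (t *\<^sub>R a) / t\<^sup>2) \<le> C * norm a ^ 4 * t\<^sup>2"
    proof eventually_elim
      case (elim t)
      have "\<bar>W (t *\<^sub>R a)\<bar> / t\<^sup>2 \<le> (C * norm (t *\<^sub>R a) ^ 4) / t\<^sup>2"
        using bd[of "t *\<^sub>R a"] elim by (intro divide_right_mono) simp_all
      also have "\<dots> = C * norm a ^ 4 * t\<^sup>2"
        using elim by (simp add: power_mult_distrib field_simps power2_eq_square power4_eq_xxxx)
      finally show ?case by simp
    qed
    have "((\<lambda>t. C * norm a ^ 4 * t\<^sup>2) \<longlongrightarrow> C * norm a ^ 4 * 0\<^sup>2) (at_right 0)"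
      by (intro tendsto_intros)
    then show "((\<lambda>t. C * norm a ^ 4 * t\<^sup>2) \<longlongrightarrow> 0) (at_right 0)" by simp
  qed
  have "DDW 0 k h = 0" for h k
  proof -
    have "((\<lambda>t. W (t *\<^sub>R (h + k)) / t\<^sup>2 - W (t *\<^sub>R h) / t\<^sup>2 - W (t *\<^sub>R k) / t\<^sup>2) \<longlongrightarrow> 0 - 0 - 0) (at_right 0)"
      by (intro tendsto_diff quot)
    moreover have "(\<lambda>t. W (t *\<^sub>R (h + k)) / t\<^sup>2 - W (t *\<^sub>R h) / t\<^sup>2 - W (t *\<^sub>R k) / t\<^sup>2)
        = (\<lambda>t. (W (0 + t *\<^sub>R h + t *\<^sub>R k) - W (0 + t *\<^sub>R h) - W (0 + t *\<^sub>R k) + W 0) / t\<^sup>2)"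
      by (simp add: W0 diff_divide_distrib scaleR_add_right)
    ultimately have "((\<lambda>t. (W (0 + t *\<^sub>R h + t *\<^sub>R k) - W (0 + t *\<^sub>R h) - W (0 + t *\<^sub>R k) + W 0) / t\<^sup>2)
        \<longlongrightarrow> 0) (at_right 0)"
      by simp
    then show ?thesis
      using mixed_difference_quotient[OF open_G z DW DDW continuous_DDW, of h k]
        tendsto_unique[OF trivial_limit_at_right_real] by blast
  qed
  then show "DDW 0 = 0" by (intro blinfun_eqI) simp
  have "(W has_derivative (\<lambda>h. 0)) (at 0)"
    unfolding has_derivative_at
  proof
    show "((\<lambda>h. norm (W (0 + h) - W 0 - 0) / norm h) \<longlongrightarrow> 0) (at 0)"
    proof (rule Lim_null_comparison)
      have "((\<lambda>h::complex \<times> complex. norm h) \<longlongrightarrow> norm (0 :: complex \<times> complex)) (at 0)"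
        by (intro tendsto_intros)
      then have "\<forall>\<^sub>F h in at (0 :: complex \<times> complex). norm h < r"
        using r by (intro order_tendstoD) auto
      then show "\<forall>\<^sub>F h in at 0. norm (norm (W (0 + h) - W 0 - 0) / norm h) \<le> C * norm h ^ 3"
      proof eventually_elim
        case (elim h)
        have "\<bar>W h\<bar> / norm h \<le> (C * norm h ^ 4) / norm h"
          using bd[of h] elim by (intro divide_right_mono) simp_all
        also have "\<dots> = C * norm h ^ 3"
          by (cases "h = 0") (simp_all add: field_simps power3_eq_cube power4_eq_xxxx)
        finally show ?case by (simp add: W0)
      qed
      have "((\<lambda>h::complex \<times> complex. C * norm h ^ 3) \<longlongrightarrow> C * norm (0 :: complex \<times> complex) ^ 3) (at 0)"
        by (intro tendsto_intros)
      then show "((\<lambda>h::complex \<times> complex. C * norm h ^ 3) \<longlongrightarrow> 0) (at 0)" by simp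
    qed
  qed simp
  then have "blinfun_apply (DW 0) = (\<lambda>h. 0)"
    using has_derivative_unique[OF DW[OF z]] by blast
  then show "DW 0 = 0" by (intro blinfun_eqI) simp
qed

section \<open>Size estimates along the stationary solution\<close>

lemma norm_z0: "(norm (z0 x))\<^sup>2 = 2 * (norm (u0 x))\<^sup>2" "norm (z0 x) \<le> 2 * norm (u0 x)"
  by (simp_all add: z0_def norm_Pair) (simp add: real_sqrt_mult sqrt2_less_2 less_imp_le mult_right_mono)

lemma norm_force_le: "norm (force x) \<le> norm (DW (z0 x))"
proof -
  have b: "\<bar>DW (z0 x) (1, 0)\<bar> \<le> norm (DW (z0 x))" "\<bar>DW (z0 x) (\<i>, 0)\<bar> \<le> norm (DW (z0 x))"
    using norm_blinfun[of "DW (z0 x)" "(1, 0)"] norm_blinfun[of "DW (z0 x)" "(\<i>, 0)"] by (simp_all add: norm_Pair)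
  have "norm (force x) \<le> (\<bar>DW (z0 x) (1, 0)\<bar> + \<bar>DW (z0 x) (\<i>, 0)\<bar>) / 2"
    unfolding force_def wirt_ubar_def norm_divide
    using norm_triangle_ineq[of "of_real (DW (z0 x) (1, 0))" "\<i> * of_real (DW (z0 x) (\<i>, 0)) :: complex"]
    by (simp add: norm_mult)
  with b show ?thesis by simp
qed

text \<open>Since \<open>DW 0\<close> and \<open>DDW 0\<close> vanish, the gradient is of smaller
  order than the distance to the origin; \<open>W\<close> itself is of fourth order.\<close>

lemma force_small:
  assumes "e > 0"
  shows "\<exists>d>0. \<forall>x. norm (u0 x) < d \<longrightarrow> norm (force x) \<le> e * norm (u0 x) \<and> \<bar>W (z0 x)\<bar> \<le> e * (norm (u0 x))\<^sup>2"
proof -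
  have z: "0 \<in> G" using zero_in_G by (simp add: zero_prod_def)
  obtain C r where r: "r > 0" and bd: "\<And>z. norm z < r \<Longrightarrow> \<bar>W z\<bar> \<le> C * norm z ^ 4"
    using analytic_order4_bound[OF order4] by blast
  have "\<exists>d>0. \<forall>y. norm (y - 0) < d \<longrightarrow> norm (DW y - DW 0 - DDW 0 (y - 0)) \<le> e / 2 * norm (y - 0)"
    using DDW[OF z] assms unfolding has_derivative_at_alt by (meson half_gt_zero)
  then obtain d where d: "d > 0" "\<And>y. norm y < d \<Longrightarrow> norm (DW y) \<le> e / 2 * norm y"
    by (auto simp: DW_zero DDW_zero)
  define K where "K = 4 * \<bar>C\<bar> + 1"
  have K: "K > 0" unfolding K_def by simp
  \<comment> \<open>The halves compensate \<open>norm (z0 x) \<le> 2 * norm (u0 x)\<close>; the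
    square root makes \<open>K * (norm (u0 x))\<^sup>2 \<le> e\<close>.\<close>
  define d' where "d' = Min {d / 2, r / 2, sqrt (e / K)}"
  have d': "d' > 0" "d' \<le> d / 2" "d' \<le> r / 2" "d' \<le> sqrt (e / K)"
    using d r assms K by (auto simp: d'_def)
  have "norm (force x) \<le> e * norm (u0 x) \<and> \<bar>W (z0 x)\<bar> \<le> e * (norm (u0 x))\<^sup>2" if x: "norm (u0 x) < d'" for x
  proof
    have "norm (force x) \<le> e / 2 * norm (z0 x)"
      using norm_force_le[of x] d(2)[of "z0 x"] norm_z0(2)[of x] x d' by simp
    also have "\<dots> \<le> e / 2 * (2 * norm (u0 x))"
      using norm_z0(2)[of x] assms by (intro mult_left_mono) auto
    finally show "norm (force x) \<le> e * norm (u0 x)" by simp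
    have "\<bar>W (z0 x)\<bar> \<le> C * norm (z0 x) ^ 4"
      using bd[of "z0 x"] norm_z0(2)[of x] x d' by simp
    also have "norm (z0 x) ^ 4 = 4 * (norm (u0 x))\<^sup>2 * (norm (u0 x))\<^sup>2"
      using arg_cong[OF norm_z0(1)[of x], of "\<lambda>y. y * y"] by (simp add: power2_eq_square power4_eq_xxxx)
    also have "C * (4 * (norm (u0 x))\<^sup>2 * (norm (u0 x))\<^sup>2) \<le> (K * (norm (u0 x))\<^sup>2) * (norm (u0 x))\<^sup>2"
      using mult_right_mono[of "4 * C" K "(norm (u0 x))\<^sup>2 * (norm (u0 x))\<^sup>2"]
      by (simp add: K_def mult_ac)
    also have "\<dots> \<le> e * (norm (u0 x))\<^sup>2"
    proof (rule mult_right_mono)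
      have "(norm (u0 x))\<^sup>2 \<le> (sqrt (e / K))\<^sup>2"
        using x d' by (intro power_mono) auto
      then have "(norm (u0 x))\<^sup>2 \<le> e / K" using assms K by simp
      then show "K * (norm (u0 x))\<^sup>2 \<le> e" using K by (simp add: field_simps)
    qed simp
    finally show "\<bar>W (z0 x)\<bar> \<le> e * (norm (u0 x))\<^sup>2" .
  qed
  with d'(1) show ?thesis by blast
qed

lemma u0_eventually_small:
  assumes "d > 0"
  shows "\<exists>R\<ge>0. \<forall>x. R \<le> \<bar>x\<bar> \<longrightarrow> norm (u0 x) < d"
proof -
  obtain b where "\<forall>x. b \<le> norm x \<longrightarrow> dist (u0 x) 0 < d"
    using tendstoD[OF decay assms] unfolding eventually_at_infinity by blast
  then show ?thesis by (intro exI[of _ "max b 0"]) auto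
qed

lemma bounded_on_line:
  assumes cont: "continuous_on UNIV f" and "\<And>x::real. R \<le> \<bar>x\<bar> \<Longrightarrow> norm (f x) \<le> M"
  shows "\<exists>C. \<forall>x. norm (f x) \<le> C"
proof -
  have "compact (f ` {- R..R})"
    by (intro compact_continuous_image compact_Icc continuous_on_subset[OF cont]) auto
  then have "bounded (f ` {- R..R})" by (rule compact_imp_bounded)
  then obtain C where C: "\<And>x. x \<in> {- R..R} \<Longrightarrow> norm (f x) \<le> C"
    unfolding bounded_iff by (metis imageI)
  have "norm (f x) \<le> max C M" for x
  proof (cases "R \<le> \<bar>x\<bar>")
    case True
    then show ?thesis using assms(2) by (meson max.coboundedI2)
  next
    case False
    then have "x \<in> {- R..R}" by (simp add: abs_if split: if_splits)
    then show ?thesis using C by (simp add: max.coboundedI1)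
  qed
  then show ?thesis by blast
qed

lemma u0_bounded: "\<exists>C. \<forall>x. norm (u0 x) \<le> C"
  using u0_eventually_small[of 1] bounded_on_line[OF continuous_u0[of UNIV], of _ 1] by (metis less_imp_le zero_less_one)

lemma continuous_force: "continuous_on A force"
  using force_deriv by (meson continuous_at_imp_continuous_on has_vector_derivative_continuous)

lemma continuous_u0': "continuous_on A u0'"
  unfolding u0'_def[abs_def] by (intro continuous_intros continuous_u0 continuous_force)

text \<open>Where \<open>u0\<close> is small, \<open>force_small\<close> applies; elsewhere
  \<open>norm (u0 x)\<close> is at least \<open>d\<close> and the bounded force is absorbed by the
  factor \<open>M / d\<close>. This linear bound makes zeros of \<open>u0\<close> propagate and
  passes square integrability from \<open>u0\<close> to \<open>u0'\<close>.\<close>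

lemma u0'_le: "\<exists>C. \<forall>x. norm (u0' x) \<le> C * norm (u0 x)"
proof -
  obtain d where d: "d > 0" "\<And>x. norm (u0 x) < d \<Longrightarrow> norm (force x) \<le> 1 * norm (u0 x)"
    using force_small[of 1] by auto
  obtain R where R: "\<And>x. R \<le> \<bar>x\<bar> \<Longrightarrow> norm (u0 x) < d" using u0_eventually_small[OF d(1)] by blast
  have "\<exists>M. \<forall>x. norm (force x) \<le> M"
  proof (rule bounded_on_line[OF continuous_force])
    show "norm (force x) \<le> d" if "R \<le> \<bar>x\<bar>" for x using R[OF that] d(2)[of x] by simp
  qed
  then obtain M where M: "\<And>x. norm (force x) \<le> M" by blast
  have M0: "0 \<le> M" using M[of 0] norm_ge_zero order_trans by blast
  have "norm (force x) \<le> (1 + M / d) * norm (u0 x)" for x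
  proof (cases "norm (u0 x) < d")
    case True
    then have "norm (force x) \<le> 1 * norm (u0 x)" by (rule d(2))
    also have "\<dots> \<le> (1 + M / d) * norm (u0 x)" using d M0 by (intro mult_right_mono) auto
    finally show ?thesis .
  next
    case False
    have "norm (force x) \<le> M" by (rule M)
    also have "\<dots> = M / d * d" using d by simp
    also have "\<dots> \<le> M / d * norm (u0 x)" using False d M0 by (intro mult_left_mono) auto
    also have "\<dots> \<le> (1 + M / d) * norm (u0 x)" by (simp add: algebra_simps)
    finally show ?thesis .
  qed
  moreover have "norm (u0' x) \<le> \<bar>\<omega>\<bar> * norm (u0 x) + norm (u0 x) + norm (force x)" for x
  proof -
    have "norm (u0' x) = norm (of_real \<omega> * u0 x - cnj (u0 x) + force x)" by (simp add: u0'_def norm_mult)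
    also have "\<dots> \<le> norm (of_real \<omega> * u0 x) + norm (cnj (u0 x)) + norm (force x)"
      by (intro order_trans[OF norm_triangle_ineq] add_right_mono norm_triangle_ineq4)
    finally show ?thesis by (simp add: norm_mult)
  qed
  ultimately have "norm (u0' x) \<le> \<bar>\<omega>\<bar> * norm (u0 x) + norm (u0 x) + (1 + M / d) * norm (u0 x)" for x
    by (meson add_left_mono order_trans)
  then have "norm (u0' x) \<le> (\<bar>\<omega>\<bar> + 1 + (1 + M / d)) * norm (u0 x)" for x
    by (simp add: distrib_right)
  then show ?thesis by blast
qed

lemma u0_zero_unique:
  assumes "u0 y = 0"
  shows "u0 x = 0"
proof -
  obtain C where "\<And>x. norm (u0' x) \<le> C * norm (u0 x)" using u0'_le by blast
  then show ?thesis by (intro ode_zero_unique[OF u0_deriv _ assms]) blast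
qed

text \<open>The stationary equation is Hamiltonian in \<open>x\<close> with this conserved quantity,
  and decay at infinity fixes its value as zero.\<close>

lemma energy: "2 * \<omega> * (norm (u0 x))\<^sup>2 - 2 * Re ((u0 x)\<^sup>2) + W (z0 x) = 0"
proof -
  define h where "h x = 2 * \<omega> * (norm (u0 x))\<^sup>2 - 2 * Re ((u0 x)\<^sup>2) + W (z0 x)" for x
  have h': "h x = 2 * \<omega> * ((Re (u0 x))\<^sup>2 + (Im (u0 x))\<^sup>2) - 2 * ((Re (u0 x))\<^sup>2 - (Im (u0 x))\<^sup>2) + W (z0 x)" for x
    by (simp add: h_def cmod_power2) (simp add: power2_eq_square)
  have dh: "(h has_real_derivative 0) (at x)" for x
  proof -
    have dRe: "((\<lambda>x. Re (u0 x)) has_real_derivative Re (u0' x)) (at x)"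
      and dIm: "((\<lambda>x. Im (u0 x)) has_real_derivative Im (u0' x)) (at x)"
      using bounded_linear.has_vector_derivative[OF bounded_linear_Re u0_deriv]
        bounded_linear.has_vector_derivative[OF bounded_linear_Im u0_deriv]
      by (simp_all add: has_real_derivative_iff_has_vector_derivative)
    have dW: "((\<lambda>x. W (z0 x)) has_real_derivative DW (z0 x) (u0' x, cnj (u0' x))) (at x)"
      using has_derivative_compose[OF z0_deriv[unfolded has_vector_derivative_def] DW[OF z0_in_G]]
      unfolding has_real_derivative_iff_has_vector_derivative has_vector_derivative_def blinfun.scaleR_right .
    have "(h has_real_derivative
        2 * \<omega> * (2 * Re (u0 x) * Re (u0' x) + 2 * Im (u0 x) * Im (u0' x))
        - 2 * (2 * Re (u0 x) * Re (u0' x) - 2 * Im (u0 x) * Im (u0' x))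
        + DW (z0 x) (u0' x, cnj (u0' x))) (at x)"
      unfolding h'[abs_def] by (rule derivative_eq_intros dRe dIm dW refl | simp)+
    moreover have "2 * \<omega> * (2 * Re (u0 x) * Re (u0' x) + 2 * Im (u0 x) * Im (u0' x))
        - 2 * (2 * Re (u0 x) * Re (u0' x) - 2 * Im (u0 x) * Im (u0' x))
        + DW (z0 x) (u0' x, cnj (u0' x)) = 0"
    proof -
      \<comment> \<open>The gradient of \<open>W\<close> is expressed by \<open>force\<close>;
        substituting the equation for \<open>u0'\<close> then makes all terms cancel.\<close>
      have f: "DW (z0 x) (1, 0) = 2 * Re (force x)" "DW (z0 x) (\<i>, 0) = 2 * Im (force x)"
        by (simp_all add: force_def wirt_ubar_def)
      have u: "Re (u0' x) = \<omega> * Im (u0 x) + Im (u0 x) + Im (force x)"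
        "Im (u0' x) = Re (u0 x) - \<omega> * Re (u0 x) - Re (force x)"
        by (simp_all add: u0'_def)
      show ?thesis
        unfolding DW_z0[of x "u0' x" "cnj (u0' x)"] f cnj.sel u by (simp add: algebra_simps)
    qed
    ultimately show ?thesis by simp
  qed
  have const: "h x = h 0" for x
    using DERIV_isconst_all[of h x 0] dh by blast
  have lim: "(h \<longlongrightarrow> 0) at_infinity"
  proof -
    have "(z0 \<longlongrightarrow> (0, cnj 0)) at_infinity"
      unfolding z0_def[abs_def] by (intro tendsto_intros decay)
    then have "(z0 \<longlongrightarrow> 0) at_infinity" by (simp add: zero_prod_def)
    moreover have "isCont W 0"
      using has_derivative_continuous[OF DW[OF zero_in_G]] by (simp add: zero_prod_def)
    ultimately have "((\<lambda>x. W (z0 x)) \<longlongrightarrow> W 0) at_infinity"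
      using isCont_tendsto_compose by blast
    then have "(h \<longlongrightarrow> 2 * \<omega> * (norm (0::complex))\<^sup>2 - 2 * Re (0\<^sup>2) + W 0) at_infinity"
      unfolding h_def[abs_def] by (intro tendsto_intros decay)
    then show ?thesis by (simp add: W_zero)
  qed
  have "h = (\<lambda>x. h 0)" using const by (intro ext)
  with lim have "((\<lambda>x::real. h 0) \<longlongrightarrow> 0) at_infinity" by simp
  then have "h 0 = 0"
    using LIMSEQ_const_iff lim_infinity_imp_sequentially by blast
  then show ?thesis using const[of x] by (simp add: h_def)
qed

text \<open>At one far point, where \<open>n\<close> is the squared modulus, the energy identity
  gives \<open>2 * \<bar>\<omega>\<bar> * n \<le> 2 * n + e * n\<close> with
  \<open>e = \<bar>\<omega>\<bar> - 1\<close>, which forces \<open>n = 0\<close>. A single zero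
  spreads to the whole line.\<close>

lemma u0_zero_if_omega_large:
  assumes "\<bar>\<omega>\<bar> > 1"
  shows "u0 x = 0"
proof -
  define e where "e = \<bar>\<omega>\<bar> - 1"
  have e: "e > 0" using assms by (simp add: e_def)
  obtain d where d: "d > 0" "\<And>x. norm (u0 x) < d \<Longrightarrow> \<bar>W (z0 x)\<bar> \<le> e * (norm (u0 x))\<^sup>2"
    using force_small[OF e] by blast
  obtain R where "\<And>x. R \<le> \<bar>x\<bar> \<Longrightarrow> norm (u0 x) < d" using u0_eventually_small[OF d(1)] by blast
  then have y: "norm (u0 \<bar>R\<bar>) < d" by simp
  define n where "n = (norm (u0 \<bar>R\<bar>))\<^sup>2"
  have "\<bar>Re ((u0 \<bar>R\<bar>)\<^sup>2)\<bar> \<le> n"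
    using abs_Re_le_cmod[of "(u0 \<bar>R\<bar>)\<^sup>2"] by (simp add: n_def norm_power)
  moreover have "\<bar>W (z0 \<bar>R\<bar>)\<bar> \<le> e * n" using d(2)[OF y] by (simp add: n_def)
  moreover have "2 * \<omega> * n - 2 * Re ((u0 \<bar>R\<bar>)\<^sup>2) + W (z0 \<bar>R\<bar>) = 0" using energy by (simp add: n_def)
  ultimately have "2 * \<bar>\<omega> * n\<bar> \<le> 2 * n + e * n" by linarith
  moreover have "\<bar>\<omega> * n\<bar> = \<bar>\<omega>\<bar> * n" by (simp add: abs_mult n_def)
  ultimately have "e * n \<le> 0" by (simp add: e_def algebra_simps)
  then have "n \<le> 0" using e by (simp add: mult_le_0_iff)
  then have "u0 \<bar>R\<bar> = 0" by (simp add: n_def)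
  then show ?thesis by (rule u0_zero_unique)
qed

text \<open>Far out, the bounded quantity \<open>Im ((u0 x)\<^sup>2)\<close> has derivative at least
  a positive multiple of the squared modulus; integrating bounds the mass outside a compact
  interval.\<close>

lemma u0_square_integrable_if_omega_small:
  assumes "\<bar>\<omega>\<bar> < 1"
  shows "square_integrable u0"
proof -
  define \<kappa> where "\<kappa> = 1 - \<omega>\<^sup>2"
  have \<kappa>: "\<kappa> > 0" using assms by (simp add: \<kappa>_def abs_square_less_1)
  obtain d where d: "d > 0" "\<And>x. norm (u0 x) < d \<Longrightarrow>
      norm (force x) \<le> \<kappa> / 4 * norm (u0 x) \<and> \<bar>W (z0 x)\<bar> \<le> \<kappa> / 4 * (norm (u0 x))\<^sup>2"
    using force_small[of "\<kappa> / 4"] \<kappa> by auto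
  obtain R where R0: "R \<ge> 0" and R: "\<And>x. R \<le> \<bar>x\<bar> \<Longrightarrow> norm (u0 x) < d"
    using u0_eventually_small[OF d(1)] by blast
  define n where "n x = (norm (u0 x))\<^sup>2" for x
  have n0: "n x \<ge> 0" for x by (simp add: n_def)
  have cn: "continuous_on A n" for A unfolding n_def[abs_def] by (intro continuous_intros continuous_u0)
  then have ni: "n integrable_on {a..b}" for a b by (rule integrable_continuous_real)
  define Q where "Q x = Im ((u0 x)\<^sup>2)" for x
  define Q' where "Q' x = 2 * Im (u0 x * u0' x)" for x
  have dQ: "(Q has_vector_derivative Q' x) (at x)" for x
    using bounded_linear.has_vector_derivative[OF bounded_linear_Im has_vector_derivative_mult[OF u0_deriv u0_deriv]]
    unfolding Q_def[abs_def] Q'_def power2_eq_square by (simp add: mult.commute)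
  have Q'_ge: "\<kappa> * n x \<le> Q' x" if x: "R \<le> \<bar>x\<bar>" for x
  proof -
    \<comment> \<open>The zero energy level eliminates the indefinite term
      \<open>Re (u0 x * u0 x)\<close> and leaves \<open>2 * \<kappa> * n x\<close> as the main part
      of \<open>Q' x\<close>.\<close>
    have Re2: "Re (u0 x * u0 x) = \<omega> * n x + W (z0 x) / 2"
      using energy[of x] by (simp add: n_def power2_eq_square)
    have nn: "n x = Re (u0 x * cnj (u0 x))"
      by (simp add: n_def complex_mult_cnj cmod_power2)
    have "Q' x = - 2 * \<omega> * Re (u0 x * u0 x) + 2 * Re (u0 x * cnj (u0 x)) - 2 * Re (u0 x * force x)"
      by (simp add: Q'_def u0'_def algebra_simps)
    also have "\<dots> = 2 * \<kappa> * n x - \<omega> * W (z0 x) - 2 * Re (u0 x * force x)"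
      unfolding Re2 nn[symmetric] by (simp add: \<kappa>_def algebra_simps power2_eq_square)
    finally have eq: "Q' x = 2 * \<kappa> * n x - \<omega> * W (z0 x) - 2 * Re (u0 x * force x)" .
    have "\<omega> * W (z0 x) \<le> \<bar>\<omega>\<bar> * \<bar>W (z0 x)\<bar>" by (metis abs_ge_self abs_mult)
    also have "\<dots> \<le> 1 * (\<kappa> / 4 * n x)"
      using assms d(2)[OF R[OF x]] by (intro mult_mono) (auto simp: n_def)
    finally have 1: "\<omega> * W (z0 x) \<le> \<kappa> / 4 * n x" by simp
    have "Re (u0 x * force x) \<le> norm (u0 x) * norm (force x)"
      by (metis complex_Re_le_cmod norm_mult)
    also have "\<dots> \<le> norm (u0 x) * (\<kappa> / 4 * norm (u0 x))"
      using d(2)[OF R[OF x]] by (intro mult_left_mono) auto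
    finally have 2: "Re (u0 x * force x) \<le> \<kappa> / 4 * n x"
      by (simp add: n_def power2_eq_square mult_ac)
    have "\<kappa> * n x \<ge> 0" using \<kappa> n0 by simp
    \<comment> \<open>The two error terms consume at most \<open>\<kappa> / 4 + \<kappa> / 2\<close>
      of the factor \<open>2 * \<kappa>\<close>.\<close>
    then show ?thesis using eq 1 2 by linarith
  qed
  obtain B where B: "\<And>x. \<bar>Q x\<bar> \<le> B"
  proof -
    obtain C where C: "\<And>x. norm (u0 x) \<le> C" using u0_bounded by blast
    have "\<bar>Q x\<bar> \<le> C\<^sup>2" for x
    proof -
      have "\<bar>Q x\<bar> \<le> (norm (u0 x))\<^sup>2" unfolding Q_def by (metis abs_Im_le_cmod norm_power)
      also have "\<dots> \<le> C\<^sup>2" using C by (intro power_mono) auto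
      finally show ?thesis .
    qed
    then show ?thesis by (rule that)
  qed
  \<comment> \<open>The bound is independent of the interval because \<open>Q\<close> is bounded on
    the whole line.\<close>
  have part: "integral {a..b} n \<le> 2 * B / \<kappa>" if ab: "a \<le> b" and out: "\<And>x. x \<in> {a..b} \<Longrightarrow> R \<le> \<bar>x\<bar>" for a b
  proof -
    have Qi: "(Q' has_integral (Q b - Q a)) {a..b}"
      by (rule fundamental_theorem_of_calculus[OF ab has_vector_derivative_at_within[OF dQ]])
    have "\<kappa> * integral {a..b} n = integral {a..b} (\<lambda>x. \<kappa> * n x)" by simp
    also have "\<dots> \<le> integral {a..b} Q'"
    proof (rule integral_le)
      show "(\<lambda>x. \<kappa> * n x) integrable_on {a..b}"
        by (intro integrable_continuous_real continuous_intros cn)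
      show "Q' integrable_on {a..b}" using Qi by (rule has_integral_integrable)
    qed (use Q'_ge out in auto)
    also have "\<dots> = Q b - Q a" using Qi by (rule integral_unique)
    also have "\<dots> \<le> 2 * B" using B[of a] B[of b] by linarith
    finally show ?thesis using \<kappa> by (simp add: field_simps)
  qed
  have sub: "integral {a..b} n \<le> integral {a'..b'} n" if "a' \<le> a" "b \<le> b'" for a b a' b'
    using that n0 by (intro integral_subset_le ni) auto
  show ?thesis
  proof (rule square_integrableI_bounded_integrals[OF continuous_u0])
    fix m :: nat
    \<comment> \<open>Enlarging to at least \<open>R\<close> lets the interval be split at
      \<open>- R\<close> and \<open>R\<close>.\<close>
    define N where "N = max (real m) R"
    have N: "real m \<le> N" "R \<le> N" "- N \<le> - R" "- R \<le> R" using R0 by (auto simp: N_def)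
    have "integral {- real m..real m} n \<le> integral {- N..N} n" by (rule sub) (use N in auto)
    also have "\<dots> = integral {- N..- R} n + integral {- R..R} n + integral {R..N} n"
      using N ni by (simp add: Henstock_Kurzweil_Integration.integral_combine[symmetric, of "- N" "R" N]
        Henstock_Kurzweil_Integration.integral_combine[symmetric, of "- N" "- R" R])
    also have "\<dots> \<le> 2 * B / \<kappa> + integral {- R..R} n + 2 * B / \<kappa>"
      by (intro add_mono part order_refl) (use N in auto)
    finally show "integral {- real m..real m} (\<lambda>x. (norm (u0 x))\<^sup>2) \<le> 2 * B / \<kappa> + integral {- R..R} n + 2 * B / \<kappa>"
      by (simp add: n_def[abs_def])
  qed
qed

end

section \<open>Kernels and eigenvalues\<close>

lemma applies_AE_cong:
  assumes "applies L f h" "AE x in lborel. h x = h' x"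
  shows "applies L f h'"
proof -
  obtain f' where "ac_derivative f f'" and ae: "AE x in lborel. L f f' x = h x"
    using assms(1) unfolding applies_def by blast
  moreover have "AE x in lborel. L f f' x = h' x" using ae assms(2) by eventually_elim simp
  ultimately show ?thesis unfolding applies_def by blast
qed

lemma square_integrable_vec_nth:
  "square_integrable V \<Longrightarrow> square_integrable (\<lambda>x. V x $ i)" for V :: "real \<Rightarrow> complex ^ 'n"
  by (rule square_integrable_bounded_linear[OF _ bounded_linear_vec_nth])

lemma bounded_linear_smult: "bounded_linear (\<lambda>y::complex ^ 'n. c *s y)"
  unfolding linear_conv_bounded_linear[symmetric]
  by (auto intro!: linearI simp: vec_eq_iff distrib_left)

lemma bounded_linear_smult_sigma:
  "bounded_linear (\<lambda>y. c *s (sigma3 *v y))" "bounded_linear (\<lambda>y. c *s (sigma *v y))"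
  unfolding linear_conv_bounded_linear[symmetric]
  by (auto intro!: linearI simp: vector_2_eq_iff vector_4_eq_iff algebra_simps)

lemma applies_H_sign_smult:
  assumes "applies (H_sign s W \<omega> u0 v0) V h"
  shows "applies (H_sign s W \<omega> u0 v0) (\<lambda>x. c *s V x) (\<lambda>x. c *s h x)"
proof -
  obtain V' where ac: "ac_derivative V V'" and ae: "AE x in lborel. H_sign s W \<omega> u0 v0 V V' x = h x"
    using assms unfolding applies_def by blast
  have "H_sign s W \<omega> u0 v0 (\<lambda>x. c *s V x) (\<lambda>x. c *s V' x) x = c *s H_sign s W \<omega> u0 v0 V V' x" for x
    by (simp add: vector_2_eq_iff H_sign_def matrix_vector_mult_2 algebra_simps)
  with ae have "AE x in lborel. H_sign s W \<omega> u0 v0 (\<lambda>x. c *s V x) (\<lambda>x. c *s V' x) x = c *s h x"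
    by simp
  with ac_derivative_bounded_linear[OF ac bounded_linear_smult] show ?thesis
    unfolding applies_def by blast
qed

lemma square_integrable_continuous_bound:
  fixes f :: "real \<Rightarrow> complex" and g :: "real \<Rightarrow> complex"
  assumes "square_integrable g" "continuous_on UNIV f" "\<And>x. norm (f x) \<le> C * norm (g x)"
  shows "square_integrable f"
  using square_integrable_bound[OF assms(1) _ assms(3)] borel_measurable_continuous_onI[OF assms(2)] by simp

lemma square_integrable_vector2:
  assumes "square_integrable f" "square_integrable g"
  shows "square_integrable (\<lambda>x. vector [f x, g x] :: complex ^ 2)"
  unfolding vector_2_axis
  by (intro square_integrable_add square_integrable_bounded_linear[OF assms(1) bounded_linear_axis]
      square_integrable_bounded_linear[OF assms(2) bounded_linear_axis])

lemma ac_derivative_join: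
  assumes "ac_derivative a a'" "ac_derivative b b'"
  shows "ac_derivative (\<lambda>x. join_parts (a x) (b x)) (\<lambda>x. join_parts (a' x) (b' x))"
  using ac_derivative_add[OF ac_derivative_bounded_linear[OF assms(1) bounded_linear_join(1)]
      ac_derivative_bounded_linear[OF assms(2) bounded_linear_join(2)]]
  by (simp flip: join_parts_add)

lemma square_integrable_join:
  assumes "square_integrable a" "square_integrable b"
  shows "square_integrable (\<lambda>x. join_parts (a x) (b x))"
  using square_integrable_add[OF square_integrable_bounded_linear[OF assms(1) bounded_linear_join(1)]
      square_integrable_bounded_linear[OF assms(2) bounded_linear_join(2)]]
  by (simp flip: join_parts_add)

section \<open>The coupled system of the two blocks\<close>

definition coupled :: "(2 diff_expr \<Rightarrow> (real \<Rightarrow> complex ^ 2) \<Rightarrow> (real \<Rightarrow> complex ^ 2) \<Rightarrow> bool)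
    \<Rightarrow> 2 diff_expr \<Rightarrow> 2 diff_expr \<Rightarrow> complex \<Rightarrow> (real \<Rightarrow> complex ^ 2) \<Rightarrow> (real \<Rightarrow> complex ^ 2) \<Rightarrow> bool" where
  "coupled app A B lam a b \<longleftrightarrow>
     app A a (\<lambda>x. (\<i> * lam) *s (sigma3 *v b x)) \<and> app B b (\<lambda>x. (\<i> * lam) *s (sigma3 *v a x))"

lemma coupled_commute: "coupled app A B lam a b \<longleftrightarrow> coupled app B A lam b a"
  by (auto simp: coupled_def)

lemma coupled_L2_iff:
  "coupled applies_L2 A B lam a b \<longleftrightarrow>
     coupled applies A B lam a b \<and> square_integrable a \<and> square_integrable b"
  using square_integrable_bounded_linear[OF _ bounded_linear_smult_sigma(1)]
  by (auto simp: coupled_def applies_L2_def)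

lemma sigma3_smult: "sigma3 *v (c *s y) = c *s (sigma3 *v y)"
  by (simp add: vector_2_eq_iff)

text \<open>Elimination of \<open>b\<close>: the second operator is applied to \<open>sigma3\<close>
  times the first equation, and inserting the second equation yields the factor
  \<open>(\<i> * lam)\<^sup>2\<close>.\<close>

lemma coupled_product:
  assumes c: "coupled applies A (H_sign s W \<omega> u0 v0) lam a b"
  shows "product_problem applies (H_sign s W \<omega> u0 v0) A (- (lam\<^sup>2)) a"
proof -
  let ?F = "\<lambda>x. (\<i> * lam) *s (sigma3 *v b x)"
  let ?G = "\<lambda>x. (\<i> * lam) *s ((\<i> * lam) *s (sigma3 *v a x))"
  have "applies A a ?F" using c by (simp add: coupled_def)
  moreover have "applies (H_sign s W \<omega> u0 v0) (\<lambda>x. sigma3 *v ?F x) ?G"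
    unfolding sigma3_smult sigma3_sigma3
    by (rule applies_H_sign_smult) (use c in \<open>simp add: coupled_def\<close>)
  moreover have "sigma3 *v ?G x = (- (lam\<^sup>2)) *s a x" for x
    by (simp add: vector_2_eq_iff power2_eq_square algebra_simps)
  ultimately show ?thesis
    unfolding product_problem_def by blast
qed

text \<open>The intermediate functions are constant matrix multiples of \<open>a\<close> and
  \<open>b\<close>, so they remain square integrable.\<close>

lemma coupled_product_L2:
  assumes c: "coupled applies_L2 A (H_sign s W \<omega> u0 v0) lam a b"
  shows "product_problem applies_L2 (H_sign s W \<omega> u0 v0) A (- (lam\<^sup>2)) a"
proof -
  let ?F = "\<lambda>x. (\<i> * lam) *s (sigma3 *v b x)"
  let ?G = "\<lambda>x. (\<i> * lam) *s ((\<i> * lam) *s (sigma3 *v a x))"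
  have sq: "square_integrable a" "square_integrable b" and c': "coupled applies A (H_sign s W \<omega> u0 v0) lam a b"
    using c unfolding coupled_L2_iff by auto
  have "applies_L2 A a ?F" using c by (simp add: coupled_def)
  moreover have "applies_L2 (H_sign s W \<omega> u0 v0) (\<lambda>x. sigma3 *v ?F x) ?G"
    unfolding sigma3_smult sigma3_sigma3 applies_L2_def
    using applies_H_sign_smult[of s W \<omega> u0 v0 b _ "\<i> * lam"] c'
      square_integrable_bounded_linear[OF sq(2) bounded_linear_smult]
      square_integrable_bounded_linear[OF square_integrable_bounded_linear[OF sq(1) bounded_linear_smult_sigma(1)] bounded_linear_smult]
    unfolding coupled_def by blast
  moreover have "sigma3 *v ?G x = (- (lam\<^sup>2)) *s a x" for x
    by (simp add: vector_2_eq_iff power2_eq_square algebra_simps)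
  ultimately show ?thesis
    unfolding product_problem_def by blast
qed

lemma applies_zero: "applies (H_sign s W \<omega> u0 v0) (\<lambda>x. 0) (\<lambda>x. 0)"
proof -
  have "ac_derivative (\<lambda>x. 0) (\<lambda>x. 0 :: complex ^ 2)"
    by (rule ac_derivativeI) auto
  moreover have "H_sign s W \<omega> u0 v0 (\<lambda>x. 0) (\<lambda>x. 0) x = 0" for x
    by (simp add: vector_2_eq_iff H_sign_def matrix_vector_mult_2)
  ultimately show ?thesis unfolding applies_def by blast
qed

lemma coupled_zero_iff:
  "coupled applies_L2 A B 0 a b \<longleftrightarrow> applies_L2 A a (\<lambda>x. 0) \<and> applies_L2 B b (\<lambda>x. 0)"
  by (simp add: coupled_def)

text \<open>The resulting pair need not contain the given \<open>a\<close>. For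
  \<open>lam \<noteq> 0\<close> the partner is found by division; for \<open>lam = 0\<close> the
  system decouples, and a kernel element of either operator, paired with zero, suffices.\<close>

lemma product_coupled_L2:
  assumes p: "product_problem applies_L2 (H_sign s W \<omega> u0 v0) (H_sign s' W \<omega> u0 v0) (- (lam\<^sup>2)) a"
    and a: "\<exists>x. a x \<noteq> 0"
  shows "\<exists>a b. ((\<exists>x. a x \<noteq> 0) \<or> (\<exists>x. b x \<noteq> 0)) \<and>
    coupled applies_L2 (H_sign s' W \<omega> u0 v0) (H_sign s W \<omega> u0 v0) lam a b"
proof -
  let ?A = "H_sign s' W \<omega> u0 v0" and ?B = "H_sign s W \<omega> u0 v0"
  obtain F G where F: "applies_L2 ?A a F" and G: "applies_L2 ?B (\<lambda>x. sigma3 *v F x) G"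
    and ae: "AE x in lborel. sigma3 *v G x = (- (lam\<^sup>2)) *s a x"
    using p unfolding product_problem_def by blast
  have sq: "square_integrable a" "square_integrable (\<lambda>x. sigma3 *v F x)"
    using F G by (auto simp: applies_L2_def)
  have G_eq: "AE x in lborel. G x = (- (lam\<^sup>2)) *s (sigma3 *v a x)"
    using ae by eventually_elim (metis sigma3_sigma3 sigma3_smult)
  show ?thesis
  proof (cases "lam = 0")
    case False
    \<comment> \<open>The first coupled equation solved for \<open>b\<close>.\<close>
    define b where "b x = (1 / (\<i> * lam)) *s (sigma3 *v F x)" for x
    have "F = (\<lambda>x. (\<i> * lam) *s (sigma3 *v b x))"
      using False by (auto simp: b_def vector_2_eq_iff)
    then have 1: "applies_L2 ?A a (\<lambda>x. (\<i> * lam) *s (sigma3 *v b x))" using F by simp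
    have "applies ?B b (\<lambda>x. (1 / (\<i> * lam)) *s G x)"
      unfolding b_def by (rule applies_H_sign_smult) (use G in \<open>simp add: applies_L2_def\<close>)
    moreover have "AE x in lborel. (1 / (\<i> * lam)) *s G x = (\<i> * lam) *s (sigma3 *v a x)"
      using G_eq by eventually_elim
        (use False in \<open>simp add: vector_2_eq_iff power2_eq_square field_simps\<close>)
    ultimately have "applies ?B b (\<lambda>x. (\<i> * lam) *s (sigma3 *v a x))"
      by (rule applies_AE_cong)
    moreover have "square_integrable b"
      unfolding b_def by (rule square_integrable_bounded_linear[OF sq(2) bounded_linear_smult])
    ultimately have "coupled applies_L2 ?A ?B lam a b"
      using 1 sq(1) unfolding coupled_L2_iff by (simp add: coupled_def applies_L2_def)
    with a show ?thesis by blast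
  next
    case True
    have zero: "applies_L2 (H_sign s W \<omega> u0 v0) (\<lambda>x. 0) (\<lambda>x. 0)" for s
      using applies_zero by (simp add: applies_L2_def)
    show ?thesis
    proof (cases "\<exists>x. sigma3 *v F x \<noteq> 0")
      case nz: True
      \<comment> \<open>For \<open>lam = 0\<close> the function \<open>sigma3 *v F x\<close> lies in
        the kernel of \<open>?B\<close>, so it can be paired with a zero first component.\<close>
      have "AE x in lborel. G x = 0" using G_eq True by simp
      then have "applies_L2 ?B (\<lambda>x. sigma3 *v F x) (\<lambda>x. 0)"
        using G applies_AE_cong[of ?B _ G "\<lambda>x. 0"] by (simp add: applies_L2_def)
      with zero have "coupled applies_L2 ?A ?B lam (\<lambda>x. 0) (\<lambda>x. sigma3 *v F x)"
        by (simp add: True coupled_zero_iff)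
      with nz show ?thesis
        by (intro exI[of _ "\<lambda>x. 0"] exI[of _ "\<lambda>x. sigma3 *v F x"]) simp
    next
      case False
      have "F x = 0" for x
      proof -
        have "sigma3 *v F x = 0" using False by blast
        then have "F x $ 1 = 0" "F x $ 2 = 0"
          unfolding vector_2_eq_iff sigma3_mult by simp_all
        then show ?thesis by (simp add: vector_2_eq_iff)
      qed
      then have "F = (\<lambda>x. 0)" by (intro ext)
      with F zero have "coupled applies_L2 ?A ?B lam a (\<lambda>x. 0)"
        by (simp add: True coupled_zero_iff)
      with a show ?thesis
        by (intro exI[of _ a] exI[of _ "\<lambda>x. 0"]) simp
    qed
  qed
qed

context stationary_potential
begin

abbreviation Hp :: "2 diff_expr" where "Hp \<equiv> H_plus W \<omega> u0 (\<lambda>x. cnj (u0 x))"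
abbreviation Hm :: "2 diff_expr" where "Hm \<equiv> H_minus W \<omega> u0 (\<lambda>x. cnj (u0 x))"
abbreviation Ho :: "4 diff_expr" where "Ho \<equiv> H_omega W \<omega> u0 (\<lambda>x. cnj (u0 x))"

lemma Ho_parts:
  "V1_part (Ho U U' x) = Hp (\<lambda>x. V1_part (U x)) (\<lambda>x. V1_part (U' x)) x"
  "V2_part (Ho U U' x) = Hm (\<lambda>x. V2_part (U x)) (\<lambda>x. V2_part (U' x)) x"
  using H_omega_parts[of u0 x "\<lambda>x. cnj (u0 x)"] z0_in_G[of x] reflect_z0[of x]
  unfolding z0_def by simp_all

lemma linearized_coupled:
  assumes "linearized_problem applies W \<omega> u0 (\<lambda>x. cnj (u0 x)) lam U"
  shows "coupled applies Hp Hm lam (\<lambda>x. V1_part (U x)) (\<lambda>x. V2_part (U x))"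
proof -
  obtain U' where ac: "ac_derivative U U'" and ae: "AE x in lborel. Ho U U' x = (\<i> * lam) *s (sigma *v U x)"
    using assms unfolding linearized_problem_def applies_def by blast
  have "AE x in lborel. Hp (\<lambda>x. V1_part (U x)) (\<lambda>x. V1_part (U' x)) x = (\<i> * lam) *s (sigma3 *v V2_part (U x))"
    "AE x in lborel. Hm (\<lambda>x. V2_part (U x)) (\<lambda>x. V2_part (U' x)) x = (\<i> * lam) *s (sigma3 *v V1_part (U x))"
    using ae by (eventually_elim, metis Ho_parts parts_sigma)+
  then show ?thesis
    using ac_derivative_bounded_linear[OF ac bounded_linear_parts(1)]
      ac_derivative_bounded_linear[OF ac bounded_linear_parts(2)]
    unfolding coupled_def applies_def by blast
qed

lemma coupled_linearized:
  assumes "coupled applies Hp Hm lam a b"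
  shows "linearized_problem applies W \<omega> u0 (\<lambda>x. cnj (u0 x)) lam (\<lambda>x. join_parts (a x) (b x))"
proof -
  obtain a' where aca: "ac_derivative a a'" and aea: "AE x in lborel. Hp a a' x = (\<i> * lam) *s (sigma3 *v b x)"
    using assms unfolding coupled_def applies_def by blast
  obtain b' where acb: "ac_derivative b b'" and aeb: "AE x in lborel. Hm b b' x = (\<i> * lam) *s (sigma3 *v a x)"
    using assms unfolding coupled_def applies_def by blast
  have "AE x in lborel. Ho (\<lambda>x. join_parts (a x) (b x)) (\<lambda>x. join_parts (a' x) (b' x)) x
      = (\<i> * lam) *s (sigma *v join_parts (a x) (b x))"
    using aea aeb
  proof eventually_elim
    case (elim x)
    then show ?case
      by (subst parts_eq_iff) (simp add: Ho_parts parts_sigma)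
  qed
  with ac_derivative_join[OF aca acb] show ?thesis
    unfolding linearized_problem_def applies_def by blast
qed

lemma linearized_coupled_L2:
  assumes "linearized_problem applies_L2 W \<omega> u0 (\<lambda>x. cnj (u0 x)) lam U"
  shows "coupled applies_L2 Hp Hm lam (\<lambda>x. V1_part (U x)) (\<lambda>x. V2_part (U x))"
proof -
  have U: "square_integrable U" "linearized_problem applies W \<omega> u0 (\<lambda>x. cnj (u0 x)) lam U"
    using assms by (simp_all add: linearized_problem_def applies_L2_def)
  show ?thesis
    using linearized_coupled[OF U(2)]
      square_integrable_bounded_linear[OF U(1) bounded_linear_parts(1)]
      square_integrable_bounded_linear[OF U(1) bounded_linear_parts(2)]
    unfolding coupled_L2_iff by blast
qed

lemma coupled_linearized_L2:
  assumes "coupled applies_L2 Hp Hm lam a b"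
  shows "linearized_problem applies_L2 W \<omega> u0 (\<lambda>x. cnj (u0 x)) lam (\<lambda>x. join_parts (a x) (b x))"
proof -
  have sq: "square_integrable a" "square_integrable b" and c: "coupled applies Hp Hm lam a b"
    using assms unfolding coupled_L2_iff by auto
  have J: "square_integrable (\<lambda>x. join_parts (a x) (b x))"
    by (rule square_integrable_join[OF sq])
  from square_integrable_bounded_linear[OF J bounded_linear_smult_sigma(2)] J coupled_linearized[OF c]
  show ?thesis
    by (simp add: linearized_problem_def applies_L2_def)
qed

lemma linearized_eigenvalue_iff:
  "linearized_eigenvalue W \<omega> u0 (\<lambda>x. cnj (u0 x)) lam \<longleftrightarrow>
     (\<exists>a b. ((\<exists>x. a x \<noteq> 0) \<or> (\<exists>x. b x \<noteq> 0)) \<and> coupled applies_L2 Hp Hm lam a b)"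
proof
  assume "linearized_eigenvalue W \<omega> u0 (\<lambda>x. cnj (u0 x)) lam"
  then obtain U x where U: "U x \<noteq> 0" "linearized_problem applies_L2 W \<omega> u0 (\<lambda>x. cnj (u0 x)) lam U"
    unfolding linearized_eigenvalue_def by blast
  have "V1_part 0 = 0" "V2_part 0 = 0"
    by (simp_all add: vector_2_eq_iff V_parts)
  then have "V1_part (U x) \<noteq> 0 \<or> V2_part (U x) \<noteq> 0"
    using U(1) parts_eq_iff[of "U x" 0] by simp
  with linearized_coupled_L2[OF U(2)]
  show "\<exists>a b. ((\<exists>x. a x \<noteq> 0) \<or> (\<exists>x. b x \<noteq> 0)) \<and> coupled applies_L2 Hp Hm lam a b"
    by (intro exI[of _ "\<lambda>x. V1_part (U x)"] exI[of _ "\<lambda>x. V2_part (U x)"]) blast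
next
  assume "\<exists>a b. ((\<exists>x. a x \<noteq> 0) \<or> (\<exists>x. b x \<noteq> 0)) \<and> coupled applies_L2 Hp Hm lam a b"
  then obtain a b x where ab: "a x \<noteq> 0 \<or> b x \<noteq> 0" "coupled applies_L2 Hp Hm lam a b" by blast
  have "join_parts 0 0 = 0" by (simp add: vector_4_eq_iff join_parts_def)
  then have "join_parts (a x) (b x) \<noteq> 0"
    using ab(1) by (metis parts_join)
  with coupled_linearized_L2[OF ab(2)] show "linearized_eigenvalue W \<omega> u0 (\<lambda>x. cnj (u0 x)) lam"
    unfolding linearized_eigenvalue_def by (intro exI[of _ "\<lambda>x. join_parts (a x) (b x)"]) blast
qed

text \<open>With \<open>a = 0\<close> the first equation reduces to \<open>b = 0\<close> almost
  everywhere; continuity of \<open>b\<close> upgrades this to every point.\<close>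

lemma coupled_zero_partner:
  assumes c: "coupled applies (Hs s) B lam a b" and "lam \<noteq> 0" and a: "\<And>x. a x = 0"
  shows "b x = 0"
proof -
  obtain b' where "ac_derivative b b'" using c unfolding coupled_def applies_def by blast
  then have "continuous_on UNIV b" by (rule ac_derivative_continuous)
  then have "continuous_on UNIV (\<lambda>x. (\<i> * lam) *s (sigma3 *v b x))"
    by (rule bounded_linear.continuous_on[OF bounded_linear_smult_sigma(1)])
  note d = applies_Hs_deriv[OF c[unfolded coupled_def, THEN conjunct1] this, of x, unfolded a]
  have "((\<lambda>x. 0) has_vector_derivative (0::complex)) (at x)" by simp
  with d have "\<i> * (\<i> * lam * b x $ 1) = 0" "\<i> * (\<i> * lam * b x $ 2) = 0"
    using vector_derivative_unique_at[of "\<lambda>x. 0::complex" _ x 0] by fastforce+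
  with \<open>lam \<noteq> 0\<close> show ?thesis by (simp add: vector_2_eq_iff)
qed

section \<open>Square integrable kernels of the two operators\<close>

lemma kernel_L2I:
  assumes "dirac_solution (alpha s) (beta s) f g" "square_integrable f" "square_integrable g"
  shows "applies_L2 (Hs s) (\<lambda>x. vector [f x, g x]) (\<lambda>x. 0)"
  using dirac_applies_Hs_zero[OF assms(1)] square_integrable_vector2[OF assms(2,3)]
  by (simp add: applies_L2_def)

lemma kernel_Hm:
  assumes "square_integrable u0" "u0 x \<noteq> 0"
  shows "\<exists>b. (\<exists>x. b x \<noteq> 0) \<and> applies_L2 Hm b (\<lambda>x. 0)"
proof -
  define b :: "real \<Rightarrow> complex ^ 2" where "b = (\<lambda>x. vector [\<i> * u0 x, cnj (\<i> * u0 x)])"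
  have sq: "square_integrable (\<lambda>x. \<i> * u0 x)" "square_integrable (\<lambda>x. cnj (\<i> * u0 x))"
    by (rule square_integrable_continuous_bound[OF assms(1), where C = 1];
        auto intro!: continuous_intros continuous_u0 simp: norm_mult)+
  have "applies_L2 Hm b (\<lambda>x. 0)"
    using kernel_L2I[OF u0_solution sq] by (simp add: b_def)
  moreover have "b x \<noteq> 0" using assms(2) by (simp add: b_def vector_2_eq_iff)
  ultimately show ?thesis by blast
qed

lemma kernel_Hp:
  assumes "square_integrable u0" "u0 y \<noteq> 0"
  shows "\<exists>a. (\<exists>x. a x \<noteq> 0) \<and> applies_L2 Hp a (\<lambda>x. 0)"
proof -
  define a :: "real \<Rightarrow> complex ^ 2" where "a = (\<lambda>x. vector [u0' x, cnj (u0' x)])"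
  obtain C where C: "\<And>x. norm (u0' x) \<le> C * norm (u0 x)" using u0'_le by blast
  have sq: "square_integrable u0'" "square_integrable (\<lambda>x. cnj (u0' x))"
    by (rule square_integrable_continuous_bound[OF assms(1), where C = C];
        auto intro!: continuous_intros continuous_u0' simp: C)+
  have "applies_L2 Hp a (\<lambda>x. 0)"
    using kernel_L2I[OF u0'_solution sq] by (simp add: a_def)
  moreover have "\<exists>x. u0' x \<noteq> 0"
  \<comment> \<open>If \<open>u0'\<close> vanished, \<open>u0\<close> would be an exponential with
    exponent zero, which is square integrable only if it is zero.\<close>
  proof (rule ccontr)
    assume "\<not> ?thesis"
    then have "(u0 has_vector_derivative 0 * u0 x) (at x)" for x using u0_deriv[of x] by simp
    from exponential_ode_not_square_integrable[OF this assms(1)] assms(2) show False by blast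
  qed
  then have "\<exists>x. a x \<noteq> 0" by (auto simp: a_def vector_2_eq_iff)
  ultimately show ?thesis by blast
qed

text \<open>For \<open>u0 = 0\<close> the Hessian along \<open>z0\<close> is
  \<open>DDW 0 = 0\<close>, and the remaining constant system has no nonzero square integrable
  solution.\<close>

lemma kernel_u0_nonzero:
  assumes "applies_L2 (Hs s) V (\<lambda>x. 0)" "V y \<noteq> 0" and s: "s\<^sup>2 = 1"
  shows "\<exists>x. u0 x \<noteq> 0"
proof (rule ccontr)
  assume "\<not> ?thesis"
  then have z: "z0 x = 0" for x by (simp add: z0_def zero_prod_def)
  have "dirac_solution (alpha s) (beta s) (\<lambda>x. V x $ 1) (\<lambda>x. V x $ 2)"
    using assms(1) applies_Hs_zero_dirac by (simp add: applies_L2_def)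
  moreover have "Complex 0 0 = 0" by (simp add: complex_eq_iff)
  then have "alpha s = (\<lambda>x. \<omega>)" "beta s = (\<lambda>x. of_real (- s))"
    by (simp_all add: z pot_alpha_def pot_beta_def coef_defs DDW_zero)
  ultimately have "dirac_solution (\<lambda>x. \<omega>) (\<lambda>x. of_real (- s)) (\<lambda>x. V x $ 1) (\<lambda>x. V x $ 2)"
    by simp
  moreover have "square_integrable (\<lambda>x. V x $ 1)" "square_integrable (\<lambda>x. V x $ 2)"
    using assms(1) by (auto simp: applies_L2_def intro: square_integrable_vec_nth)
  ultimately have "V y $ 1 = 0 \<and> V y $ 2 = 0"
    using constant_dirac_not_square_integrable[of \<omega> "- s"] s by auto
  with assms(2) show False by (simp add: vector_2_eq_iff)
qed

text \<open>The kernel element is a nonzero multiple of the bounded gauge solution, so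
  \<open>norm (u0 x)\<close> is dominated by its first component.\<close>

lemma kernel_Hm_u0_square_integrable:
  assumes b: "applies_L2 Hm b (\<lambda>x. 0)" "b y \<noteq> 0"
  shows "square_integrable u0"
proof -
  have b': "applies_L2 (Hs (- 1)) b (\<lambda>x. 0)" using b(1) by simp
  obtain x0 where x0: "u0 x0 \<noteq> 0" using kernel_u0_nonzero[OF b' b(2)] by auto
  obtain C where C: "\<And>x. norm (u0 x) \<le> C" using u0_bounded by blast
  have sq: "square_integrable (\<lambda>x. b x $ i)" for i
    using b(1) by (auto simp: applies_L2_def intro: square_integrable_vec_nth)
  have sol: "dirac_solution (alpha (- 1)) (beta (- 1)) (\<lambda>x. b x $ 1) (\<lambda>x. b x $ 2)"
    using b' applies_Hs_zero_dirac by (simp add: applies_L2_def)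
  have "\<exists>c. \<forall>x. b x $ 1 = c * (\<i> * u0 x) \<and> b x $ 2 = c * cnj (\<i> * u0 x)"
    by (rule dirac_square_integrable_proportional[OF sol u0_solution continuous_alpha continuous_beta sq sq,
          where C = C and ?x0.0 = x0])
       (use C x0 in \<open>auto simp: norm_mult\<close>)
  then obtain c where c: "\<And>x. b x $ 1 = c * (\<i> * u0 x)" "\<And>x. b x $ 2 = c * cnj (\<i> * u0 x)" by blast
  have "c \<noteq> 0" using b(2) c by (auto simp: vector_2_eq_iff)
  then have "norm (u0 x) \<le> (1 / norm c) * norm (b x $ 1)" for x
    by (simp add: c norm_mult)
  then show ?thesis
    by (rule square_integrable_continuous_bound[OF sq[of 1] continuous_u0])
qed

end

section \<open>Transfer of solutions and eigenvalues\<close>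

context stationary_potential
begin

lemma linearized_product:
  assumes "linearized_problem applies W \<omega> u0 (\<lambda>x. cnj (u0 x)) lam U"
  shows "product_problem applies Hm Hp (- (lam\<^sup>2)) (\<lambda>x. V1_part (U x))"
    "product_problem applies Hp Hm (- (lam\<^sup>2)) (\<lambda>x. V2_part (U x))"
  by (rule coupled_product[OF linearized_coupled[OF assms]]
      coupled_product[OF linearized_coupled[OF assms, THEN coupled_commute[THEN iffD1]]])+

lemma linearized_product_L2:
  assumes "linearized_problem applies_L2 W \<omega> u0 (\<lambda>x. cnj (u0 x)) lam U"
  shows "product_problem applies_L2 Hm Hp (- (lam\<^sup>2)) (\<lambda>x. V1_part (U x))"
    "product_problem applies_L2 Hp Hm (- (lam\<^sup>2)) (\<lambda>x. V2_part (U x))"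
  by (rule coupled_product_L2[OF linearized_coupled_L2[OF assms]]
      coupled_product_L2[OF linearized_coupled_L2[OF assms, THEN coupled_commute[THEN iffD1]]])+

text \<open>A nonzero pair has a nonzero first component, because a vanishing first component forces
  the second to vanish.\<close>

lemma coupled_eigenvalue_nonzero:
  assumes c: "coupled applies_L2 (Hs s) (Hs s') lam a b" and "lam \<noteq> 0"
    and nz: "(\<exists>x. a x \<noteq> 0) \<or> (\<exists>x. b x \<noteq> 0)"
  shows "product_eigenvalue (Hs s') (Hs s) (- (lam\<^sup>2))"
proof -
  have "coupled applies (Hs s) (Hs s') lam a b" using c coupled_L2_iff by blast
  then have "\<exists>x. a x \<noteq> 0"
    using nz coupled_zero_partner[OF _ \<open>lam \<noteq> 0\<close>] by blast
  with coupled_product_L2[OF c] show ?thesis unfolding product_eigenvalue_def by (intro exI[of _ a]) simp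
qed

lemma kernel_product_eigenvalue:
  assumes "applies_L2 (Hs s) a (\<lambda>x. 0)" "\<exists>x. a x \<noteq> 0"
  shows "product_eigenvalue (Hs s') (Hs s) 0"
proof -
  have "coupled applies_L2 (Hs s) (Hs s') 0 a (\<lambda>x. 0)"
    using assms(1) applies_zero by (simp add: coupled_zero_iff applies_L2_def)
  from coupled_product_L2[OF this] assms(2) show ?thesis
    unfolding product_eigenvalue_def by (intro exI[of _ a]) simp
qed

text \<open>Both claims pass through the coupled system, which is symmetric under exchanging the
  operators together with the components.\<close>

lemma product_eigenvalue_linearized:
  "product_eigenvalue Hm Hp (- (lam\<^sup>2)) \<Longrightarrow> linearized_eigenvalue W \<omega> u0 (\<lambda>x. cnj (u0 x)) lam"
  "product_eigenvalue Hp Hm (- (lam\<^sup>2)) \<Longrightarrow> linearized_eigenvalue W \<omega> u0 (\<lambda>x. cnj (u0 x)) lam"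
proof -
  show "linearized_eigenvalue W \<omega> u0 (\<lambda>x. cnj (u0 x)) lam" if "product_eigenvalue Hm Hp (- (lam\<^sup>2))"
    using that unfolding linearized_eigenvalue_iff product_eigenvalue_def 
    by (elim exE conjE) (rule product_coupled_L2, assumption, rule exI)
  assume "product_eigenvalue Hp Hm (- (lam\<^sup>2))"
  then have "\<exists>a b. ((\<exists>x. a x \<noteq> 0) \<or> (\<exists>x. b x \<noteq> 0)) \<and> coupled applies_L2 Hm Hp lam a b"
    unfolding product_eigenvalue_def 
    by (elim exE conjE) (rule product_coupled_L2, assumption, rule exI)
  then obtain a b where "(\<exists>x. b x \<noteq> 0) \<or> (\<exists>x. a x \<noteq> 0)" "coupled applies_L2 Hm Hp lam a b"
    by blast
  then show "linearized_eigenvalue W \<omega> u0 (\<lambda>x. cnj (u0 x)) lam"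
    unfolding linearized_eigenvalue_iff coupled_commute[of _ Hm Hp]
    by (intro exI[of _ b] exI[of _ a] conjI)
qed

text \<open>The delicate case is \<open>lam = 0\<close>, where a kernel element of one operator has
  to produce one of the other. The bridge is square integrability of \<open>u0\<close>: a kernel
  element of \<open>H_minus\<close> forces it in the first claim, and the side condition secures it
  in the second.\<close>

lemma linearized_eigenvalue_product:
  assumes "linearized_eigenvalue W \<omega> u0 (\<lambda>x. cnj (u0 x)) lam"
  shows "product_eigenvalue Hm Hp (- (lam\<^sup>2))"
    "lam \<noteq> 0 \<or> \<bar>\<omega>\<bar> \<noteq> 1 \<or> square_integrable u0 \<Longrightarrow> product_eigenvalue Hp Hm (- (lam\<^sup>2))"
proof -
  obtain a b where nz: "(\<exists>x. a x \<noteq> 0) \<or> (\<exists>x. b x \<noteq> 0)" and c: "coupled applies_L2 Hp Hm lam a b"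
    using assms unfolding linearized_eigenvalue_iff by blast
  have "product_eigenvalue Hm Hp (- (lam\<^sup>2)) \<and> (lam \<noteq> 0 \<or> \<bar>\<omega>\<bar> \<noteq> 1 \<or> square_integrable u0 \<longrightarrow>
      product_eigenvalue Hp Hm (- (lam\<^sup>2)))"
  proof (cases "lam = 0")
    case False
    then show ?thesis
      using coupled_eigenvalue_nonzero[of 1 "- 1" lam a b] coupled_eigenvalue_nonzero[of "- 1" 1 lam b a]
        c nz coupled_commute by auto
  next
    case True
    have a: "applies_L2 Hp a (\<lambda>x. 0)" and b: "applies_L2 Hm b (\<lambda>x. 0)"
      using c by (simp_all add: True coupled_zero_iff)
    have P: "product_eigenvalue Hm Hp 0" if "applies_L2 Hp V (\<lambda>x. 0)" "\<exists>x. V x \<noteq> 0" for V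
      using kernel_product_eigenvalue[of 1 V "- 1"] that by simp
    have M: "product_eigenvalue Hp Hm 0" if "applies_L2 Hm V (\<lambda>x. 0)" "\<exists>x. V x \<noteq> 0" for V
      using kernel_product_eigenvalue[of "- 1" V 1] that by simp
    have u0: "\<exists>x. u0 x \<noteq> 0"
      using nz a b kernel_u0_nonzero[of 1 a] kernel_u0_nonzero[of "- 1" b] by auto
    have "product_eigenvalue Hm Hp 0"
    proof (cases "\<exists>x. a x \<noteq> 0")
      case True
      with P[OF a] show ?thesis by blast
    next
      case False
      \<comment> \<open>Only \<open>H_minus\<close> supplies a kernel element here; it makes
        \<open>u0\<close> square integrable, and then \<open>u0'\<close> supplies one for
        \<open>H_plus\<close>.\<close>
      with nz obtain y where "b y \<noteq> 0" by blast
      then have "square_integrable u0" by (rule kernel_Hm_u0_square_integrable[OF b])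
      with u0 kernel_Hp P show ?thesis by blast
    qed
    moreover have "product_eigenvalue Hp Hm 0" if "\<bar>\<omega>\<bar> \<noteq> 1 \<or> square_integrable u0"
    proof -
      \<comment> \<open>The value \<open>\<bar>\<omega>\<bar> > 1\<close> would give
        \<open>u0 = 0\<close>, so the side condition leaves \<open>\<bar>\<omega>\<bar> < 1\<close>
        or square integrability itself.\<close>
      have "\<not> \<bar>\<omega>\<bar> > 1" using u0 u0_zero_if_omega_large by blast
      then have "square_integrable u0"
        using that u0_square_integrable_if_omega_small by fastforce
      with u0 kernel_Hm M show ?thesis by blast
    qed
    ultimately show ?thesis by (simp add: True)
  qed
  then show "product_eigenvalue Hm Hp (- (lam\<^sup>2))"
    "lam \<noteq> 0 \<or> \<bar>\<omega>\<bar> \<noteq> 1 \<or> square_integrable u0 \<Longrightarrow> product_eigenvalue Hp Hm (- (lam\<^sup>2))"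
    by blast+
qed

end

theorem corollary4p3:
  fixes W :: "complex \<times> complex \<Rightarrow> real" and \<omega> :: real and u0 v0 :: "real \<Rightarrow> complex"
    and G :: "(complex \<times> complex) set"
  assumes "gauge_invariant W" and "swap_symmetric W" and "conj_symmetric W"
    and "analytic_order4 W"
    and "open G" and "(0, 0) \<in> G" and "\<And>x. (u0 x, v0 x) \<in> G" and "C2_on W G"
    and "stationary_solution W \<omega> u0 v0" and "decaying u0 v0"
    and "\<And>x. v0 x = cnj (u0 x)"
  defines "Hp \<equiv> H_plus W \<omega> u0 v0" and "Hm \<equiv> H_minus W \<omega> u0 v0"
  shows "(\<forall>lam U. linearized_problem applies W \<omega> u0 v0 lam U \<longrightarrow>
             product_problem applies Hm Hp (- (lam\<^sup>2)) (\<lambda>x. V1_part (U x)) \<and>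
             product_problem applies Hp Hm (- (lam\<^sup>2)) (\<lambda>x. V2_part (U x)))
       \<and> (\<forall>lam U. linearized_problem applies_L2 W \<omega> u0 v0 lam U \<longrightarrow>
             product_problem applies_L2 Hm Hp (- (lam\<^sup>2)) (\<lambda>x. V1_part (U x)) \<and>
             product_problem applies_L2 Hp Hm (- (lam\<^sup>2)) (\<lambda>x. V2_part (U x)))
       \<and> (\<forall>lam. linearized_eigenvalue W \<omega> u0 v0 lam \<longleftrightarrow> product_eigenvalue Hm Hp (- (lam\<^sup>2)))
       \<and> (\<forall>lam. product_eigenvalue Hp Hm (- (lam\<^sup>2)) \<longrightarrow> linearized_eigenvalue W \<omega> u0 v0 lam)
       \<and> (\<forall>lam. linearized_eigenvalue W \<omega> u0 v0 lam \<and>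
                (lam \<noteq> 0 \<or> \<bar>\<omega>\<bar> \<noteq> 1 \<or> square_integrable u0) \<longrightarrow>
              product_eigenvalue Hp Hm (- (lam\<^sup>2)))"
proof -
  have v0: "v0 = (\<lambda>x. cnj (u0 x))" using assms(11) by (intro ext)
  obtain DW DDW where D: "\<forall>z\<in>G. (W has_derivative blinfun_apply (DW z)) (at z)"
    "\<forall>z\<in>G. (DW has_derivative blinfun_apply (DDW z)) (at z)" "continuous_on G DDW"
    using assms(8) unfolding C2_on_def by (elim exE conjE) (rule that)
  interpret stationary_potential W G DW DDW \<omega> u0
  proof unfold_locales
    show "(u0 x, cnj (u0 x)) \<in> G" for x using assms(7)[of x] by (simp add: v0)
    show "stationary_solution W \<omega> u0 (\<lambda>x. cnj (u0 x))" using assms(9) by (simp add: v0)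
    show "(u0 \<longlongrightarrow> 0) at_infinity" using assms(10) by (simp add: decaying_def)
  qed (use assms(1-6) D in blast)+
  show ?thesis
    unfolding Hp_def Hm_def v0
    using linearized_product linearized_product_L2 product_eigenvalue_linearized
      linearized_eigenvalue_product by blast
qed

end
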